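(* Let $N^2(C)$ be a 2-dimensional space form of constant sectional curvature $C$, let $I\subset\mathbb{R}$ be an open interval, let $f:I\to\mathbb{R}^+$ be a smooth positive function, and let $\gamma:I\to N^2(C)$ be a proper $f$-3-harmonic curve parametrized by arclength. If the curvature $\kappa>0$ of $\gamma$ is constant, then $C<0$ and $\kappa=\frac{\sqrt{-C}}{2}$.
   Context: For a smooth map $\gamma:I\to N$ from an open interval $I$ (with its standard metric $ds^2$) into a Riemannian manifold $N$ and a smooth positive function $f$ on $I$, let $\overline{\nabla}_{\gamma'}$ be the covariant derivative along $\gamma$ and $\tau(\gamma)=\overline{\nabla}_{\gamma'}\gamma'$. The $f$-3-energy over a compact subinterval $\Omega\subset I$ is $E_{f,3}(\gamma)=\frac12\int_\Omega f\,|\overline{\nabla}_{\gamma'}\tau(\gamma)|^2ds$. The map $\gamma$ is $f$-3-harmonic if it is a critical point of $E_{f,3}$ with respect to all compactly supported smooth variations (through arbitrary smooth maps $I\to N$). It is 3-harmonic if this holds with $f\equiv1$. It is proper $f$-3-harmonic if it is $f$-3-harmonic but not 3-harmonic. The curvature (geodesic curvature) $\kappa$ of an arclength-parametrized curve $\gamma$ in a surface is defined by the Frenet formulas $\overline{\nabla}_{\gamma'}T=\kappa N$, $\overline{\nabla}_{\gamma'}N=-\kappa T$, where $T=\gamma'$ and $\{T,N\}$ is an orthonormal frame along $\gamma$. *)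

theory Defs
  imports "HOL-Analysis.Analysis"
begin

section \<open>Smooth functions between Euclidean spaces\<close>

text \<open>Intended for open \<open>S\<close>: derivatives are taken in the full space, not within \<open>S\<close>.\<close>

fun Ck_on :: "nat \<Rightarrow> 'a::euclidean_space set \<Rightarrow> ('a \<Rightarrow> 'b::real_normed_vector) \<Rightarrow> bool" where
  "Ck_on 0 S f \<longleftrightarrow> continuous_on S f"
| "Ck_on (Suc k) S f \<longleftrightarrow>
     (\<forall>x\<in>S. f differentiable (at x)) \<and>
     (\<forall>v. Ck_on k S (\<lambda>x. frechet_derivative f (at x) v))"

definition smooth_on :: "'a::euclidean_space set \<Rightarrow> ('a \<Rightarrow> 'b::real_normed_vector) \<Rightarrow> bool" where
  "smooth_on S f \<longleftrightarrow> (\<forall>k. Ck_on k S f)"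


section \<open>Riemannian manifolds\<close>

text \<open>
  A chart is a pair of a domain and a coordinate map.  The metric is given by its local
  expressions: \<open>metric M c x u v\<close> is the product of the tangent vectors with
  coordinates \<open>u\<close>, \<open>v\<close> in the chart \<open>c\<close>, at the point with coordinates \<open>x\<close>.
\<close>

type_synonym ('a, 'e) chart = "'a set \<times> ('a \<Rightarrow> 'e)"

record ('a, 'e) manifold =
  top_of :: "'a topology"
  atlas :: "('a, 'e) chart set"
  metric :: "('a, 'e) chart \<Rightarrow> 'e \<Rightarrow> 'e \<Rightarrow> 'e \<Rightarrow> real"

abbreviation cdom :: "('a, 'e) chart \<Rightarrow> 'a set" where "cdom \<equiv> fst"
abbreviation cmap :: "('a, 'e) chart \<Rightarrow> 'a \<Rightarrow> 'e" where "cmap \<equiv> snd"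

definition transition :: "('a, 'e) chart \<Rightarrow> ('a, 'e) chart \<Rightarrow> 'e \<Rightarrow> 'e" where
  "transition c d = cmap d \<circ> inv_into (cdom c) (cmap c)"

definition smooth_manifold :: "('a, 'e::euclidean_space) manifold \<Rightarrow> bool" where
  "smooth_manifold M \<longleftrightarrow>
     Hausdorff_space (top_of M) \<and> second_countable (top_of M) \<and>
     (\<Union>c\<in>atlas M. cdom c) = topspace (top_of M) \<and>
     (\<forall>c\<in>atlas M. openin (top_of M) (cdom c) \<and> open (cmap c ` cdom c) \<and>
        homeomorphic_map (subtopology (top_of M) (cdom c))
          (top_of_set (cmap c ` cdom c)) (cmap c)) \<and>
     (\<forall>c\<in>atlas M. \<forall>d\<in>atlas M. smooth_on (cmap c ` (cdom c \<inter> cdom d)) (transition c d))"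

definition riemannian_manifold :: "('a, 'e::euclidean_space) manifold \<Rightarrow> bool" where
  "riemannian_manifold M \<longleftrightarrow>
     smooth_manifold M \<and>
     (\<forall>c\<in>atlas M.
        (\<forall>u v. smooth_on (cmap c ` cdom c) (\<lambda>x. metric M c x u v)) \<and>
        (\<forall>x\<in>cmap c ` cdom c.
           bilinear (metric M c x) \<and>
           (\<forall>u v. metric M c x u v = metric M c x v u) \<and>
           (\<forall>u. u \<noteq> 0 \<longrightarrow> metric M c x u u > 0))) \<and>
     (\<forall>c\<in>atlas M. \<forall>d\<in>atlas M. \<forall>p\<in>cdom c \<inter> cdom d. \<forall>u v.
        metric M c (cmap c p) u v =
        metric M d (cmap d p)
          (frechet_derivative (transition c d) (at (cmap c p)) u)
          (frechet_derivative (transition c d) (at (cmap c p)) v))"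

definition smooth_into ::
  "('a, 'e::euclidean_space) manifold \<Rightarrow> 'd::euclidean_space set \<Rightarrow> ('d \<Rightarrow> 'a) \<Rightarrow> bool" where
  "smooth_into M S F \<longleftrightarrow>
     continuous_map (top_of_set S) (top_of M) F \<and>
     (\<forall>c\<in>atlas M. smooth_on {x\<in>S. F x \<in> cdom c} (cmap c \<circ> F))"

text \<open>
  \<open>christoffel M c x u v\<close> is the Levi-Civita derivative of the constant coordinate field \<open>v\<close>
  in direction \<open>u\<close>.  It is determined by the Koszul formula, whose bracket terms vanish for
  constant coordinate fields.  On basis vectors its components are the Christoffel symbols.
\<close>

definition christoffel ::
  "('a, 'e::euclidean_space) manifold \<Rightarrow> ('a, 'e) chart \<Rightarrow> 'e \<Rightarrow> 'e \<Rightarrow> 'e \<Rightarrow> 'e" where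
  "christoffel M c x u v = (THE w. \<forall>z. 2 * metric M c x w z =
       frechet_derivative (\<lambda>y. metric M c y v z) (at x) u
     + frechet_derivative (\<lambda>y. metric M c y u z) (at x) v
     - frechet_derivative (\<lambda>y. metric M c y u v) (at x) z)"

text \<open>The convention is \<open>R(u,v)w = \<nabla>\<^sub>u \<nabla>\<^sub>v w - \<nabla>\<^sub>v \<nabla>\<^sub>u w\<close> for constant coordinate fields.\<close>

definition curvature_tensor ::
  "('a, 'e::euclidean_space) manifold \<Rightarrow> ('a, 'e) chart \<Rightarrow> 'e \<Rightarrow> 'e \<Rightarrow> 'e \<Rightarrow> 'e \<Rightarrow> 'e" where
  "curvature_tensor M c x u v w =
       frechet_derivative (\<lambda>y. christoffel M c y v w) (at x) u
     - frechet_derivative (\<lambda>y. christoffel M c y u w) (at x) v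
     + christoffel M c x u (christoffel M c x v w)
     - christoffel M c x v (christoffel M c x u w)"

definition sectional_curvature ::
  "('a, 'e::euclidean_space) manifold \<Rightarrow> ('a, 'e) chart \<Rightarrow> 'e \<Rightarrow> 'e \<Rightarrow> 'e \<Rightarrow> real" where
  "sectional_curvature M c x u v =
     metric M c x (curvature_tensor M c x u v v) u /
     (metric M c x u u * metric M c x v v - (metric M c x u v)\<^sup>2)"

definition constant_sectional_curvature ::
  "('a, 'e::euclidean_space) manifold \<Rightarrow> real \<Rightarrow> bool" where
  "constant_sectional_curvature M C \<longleftrightarrow>
     (\<forall>c\<in>atlas M. \<forall>x\<in>cmap c ` cdom c. \<forall>u v.
        u \<noteq> v \<and> independent {u, v} \<longrightarrow> sectional_curvature M c x u v = C)"


section \<open>Vector fields along curves\<close>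

text \<open>
  A vector field along a curve \<open>\<gamma>\<close> is represented by its coordinates in every chart:
  \<open>X c s\<close> is the coordinate vector of \<open>X(s)\<close> in the chart \<open>c\<close>, and is meaningful only
  when \<open>\<gamma> s \<in> cdom c\<close>.
\<close>

type_synonym ('a, 'e) vfield = "('a, 'e) chart \<Rightarrow> real \<Rightarrow> 'e"

definition smooth_vfield_along ::
  "('a, 'e::euclidean_space) manifold \<Rightarrow> real set \<Rightarrow> (real \<Rightarrow> 'a) \<Rightarrow> ('a, 'e) vfield \<Rightarrow> bool" where
  "smooth_vfield_along M I \<gamma> X \<longleftrightarrow>
     (\<forall>c\<in>atlas M. smooth_on {s\<in>I. \<gamma> s \<in> cdom c} (X c)) \<and>
     (\<forall>c\<in>atlas M. \<forall>d\<in>atlas M. \<forall>s\<in>I. \<gamma> s \<in> cdom c \<inter> cdom d \<longrightarrow>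
        X d s = frechet_derivative (transition c d) (at (cmap c (\<gamma> s))) (X c s))"

definition vfield_eq ::
  "('a, 'e::euclidean_space) manifold \<Rightarrow> real set \<Rightarrow> (real \<Rightarrow> 'a) \<Rightarrow>
     ('a, 'e) vfield \<Rightarrow> ('a, 'e) vfield \<Rightarrow> bool" where
  "vfield_eq M I \<gamma> X Y \<longleftrightarrow> (\<forall>c\<in>atlas M. \<forall>s\<in>I. \<gamma> s \<in> cdom c \<longrightarrow> X c s = Y c s)"

definition velocity :: "(real \<Rightarrow> 'a) \<Rightarrow> ('a, 'e::euclidean_space) vfield" where
  "velocity \<gamma> = (\<lambda>c s. vector_derivative (cmap c \<circ> \<gamma>) (at s))"

definition covariant_deriv ::
  "('a, 'e::euclidean_space) manifold \<Rightarrow> (real \<Rightarrow> 'a) \<Rightarrow> ('a, 'e) vfield \<Rightarrow> ('a, 'e) vfield" where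
  "covariant_deriv M \<gamma> X = (\<lambda>c s.
     vector_derivative (X c) (at s) + christoffel M c (cmap c (\<gamma> s)) (velocity \<gamma> c s) (X c s))"

definition tension :: "('a, 'e::euclidean_space) manifold \<Rightarrow> (real \<Rightarrow> 'a) \<Rightarrow> ('a, 'e) vfield" where
  "tension M \<gamma> = covariant_deriv M \<gamma> (velocity \<gamma>)"

text \<open>By compatibility of the local metrics, the choice of the chart is immaterial.\<close>

definition inner_along ::
  "('a, 'e::euclidean_space) manifold \<Rightarrow> (real \<Rightarrow> 'a) \<Rightarrow>
     ('a, 'e) vfield \<Rightarrow> ('a, 'e) vfield \<Rightarrow> real \<Rightarrow> real" where
  "inner_along M \<gamma> X Y s =
     (let c = (SOME c. c \<in> atlas M \<and> \<gamma> s \<in> cdom c)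
      in metric M c (cmap c (\<gamma> s)) (X c s) (Y c s))"

definition norm_along ::
  "('a, 'e::euclidean_space) manifold \<Rightarrow> (real \<Rightarrow> 'a) \<Rightarrow> ('a, 'e) vfield \<Rightarrow> real \<Rightarrow> real" where
  "norm_along M \<gamma> X s = sqrt (inner_along M \<gamma> X X s)"

definition arclength_parametrized ::
  "('a, 'e::euclidean_space) manifold \<Rightarrow> real set \<Rightarrow> (real \<Rightarrow> 'a) \<Rightarrow> bool" where
  "arclength_parametrized M I \<gamma> \<longleftrightarrow>
     smooth_into M I \<gamma> \<and> (\<forall>s\<in>I. norm_along M \<gamma> (velocity \<gamma>) s = 1)"

text \<open>
  For curves in surfaces.  The normal field \<open>N\<close> is determined only up to sign, hence so is
  the curvature \<open>\<kappa>\<close>.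
\<close>

definition has_geodesic_curvature ::
  "('a, real^2) manifold \<Rightarrow> real set \<Rightarrow> (real \<Rightarrow> 'a) \<Rightarrow> (real \<Rightarrow> real) \<Rightarrow> bool" where
  "has_geodesic_curvature M I \<gamma> \<kappa> \<longleftrightarrow>
     (\<exists>N. smooth_vfield_along M I \<gamma> N \<and>
        (\<forall>s\<in>I. inner_along M \<gamma> (velocity \<gamma>) (velocity \<gamma>) s = 1 \<and>
               inner_along M \<gamma> N N s = 1 \<and>
               inner_along M \<gamma> (velocity \<gamma>) N s = 0) \<and>
        vfield_eq M I \<gamma> (covariant_deriv M \<gamma> (velocity \<gamma>)) (\<lambda>c s. \<kappa> s *\<^sub>R N c s) \<and>
        vfield_eq M I \<gamma> (covariant_deriv M \<gamma> N) (\<lambda>c s. - \<kappa> s *\<^sub>R velocity \<gamma> c s))"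


section \<open>Space forms\<close>

definition geodesically_complete :: "('a, 'e::euclidean_space) manifold \<Rightarrow> bool" where
  "geodesically_complete M \<longleftrightarrow>
     (\<forall>c\<in>atlas M. \<forall>p\<in>cdom c. \<forall>v. \<exists>\<sigma>. smooth_into M UNIV \<sigma> \<and>
        \<sigma> 0 = p \<and> velocity \<sigma> c 0 = v \<and>
        vfield_eq M UNIV \<sigma> (tension M \<sigma>) (\<lambda>_ _. 0))"

definition space_form :: "('a, 'e::euclidean_space) manifold \<Rightarrow> real \<Rightarrow> bool" where
  "space_form M C \<longleftrightarrow>
     riemannian_manifold M \<and> connected_space (top_of M) \<and> geodesically_complete M \<and>
     constant_sectional_curvature M C"


section \<open>The f-3-energy and its critical points\<close>

definition energy3 ::
  "('a, 'e::euclidean_space) manifold \<Rightarrow> (real \<Rightarrow> real) \<Rightarrow> real set \<Rightarrow> (real \<Rightarrow> 'a) \<Rightarrow> real" where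
  "energy3 M f \<Omega> \<gamma> =
     1/2 * integral \<Omega> (\<lambda>s. f s * (norm_along M \<gamma> (covariant_deriv M \<gamma> (tension M \<gamma>)) s)\<^sup>2)"

text \<open>
  A smooth variation \<open>\<Phi> t\<close> (\<open>\<bar>t\<bar> < \<epsilon>\<close>) of \<open>\<gamma>\<close> through smooth maps into \<open>M\<close>,
  supported in the set \<open>K\<close>.
\<close>

definition variation_supported_in ::
  "('a, 'e::euclidean_space) manifold \<Rightarrow> real set \<Rightarrow> (real \<Rightarrow> 'a) \<Rightarrow> real set \<Rightarrow>
     real \<Rightarrow> (real \<Rightarrow> real \<Rightarrow> 'a) \<Rightarrow> bool" where
  "variation_supported_in M I \<gamma> K \<epsilon> \<Phi> \<longleftrightarrow>
     \<epsilon> > 0 \<and>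
     smooth_into M ({-\<epsilon><..<\<epsilon>} \<times> I) (\<lambda>(t, s). \<Phi> t s) \<and>
     (\<forall>s\<in>I. \<Phi> 0 s = \<gamma> s) \<and>
     (\<forall>t\<in>{-\<epsilon><..<\<epsilon>}. \<forall>s\<in>I - K. \<Phi> t s = \<gamma> s)"

definition f_3_harmonic ::
  "('a, 'e::euclidean_space) manifold \<Rightarrow> real set \<Rightarrow> (real \<Rightarrow> real) \<Rightarrow> (real \<Rightarrow> 'a) \<Rightarrow> bool" where
  "f_3_harmonic M I f \<gamma> \<longleftrightarrow>
     smooth_into M I \<gamma> \<and>
     (\<forall>a b K \<epsilon> \<Phi>.
        {a..b} \<subseteq> I \<and> compact K \<and> K \<subseteq> {a..b} \<and> variation_supported_in M I \<gamma> K \<epsilon> \<Phi> \<longrightarrow>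
        ((\<lambda>t. energy3 M f {a..b} (\<Phi> t)) has_real_derivative 0) (at 0))"

definition three_harmonic ::
  "('a, 'e::euclidean_space) manifold \<Rightarrow> real set \<Rightarrow> (real \<Rightarrow> 'a) \<Rightarrow> bool" where
  "three_harmonic M I \<gamma> \<longleftrightarrow> f_3_harmonic M I (\<lambda>_. 1) \<gamma>"

definition proper_f_3_harmonic ::
  "('a, 'e::euclidean_space) manifold \<Rightarrow> real set \<Rightarrow> (real \<Rightarrow> real) \<Rightarrow> (real \<Rightarrow> 'a) \<Rightarrow> bool" where
  "proper_f_3_harmonic M I f \<gamma> \<longleftrightarrow> f_3_harmonic M I f \<gamma> \<and> \<not> three_harmonic M I \<gamma>"

end

theory Submission
  imports Defs
begin

text \<open>
  Let \<open>T\<close>, \<open>N\<close> be the Frenet frame and \<open>k\<close> the constant curvature, so that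
  \<open>\<nabla>\<^sub>T\<nabla>\<^sub>T T = - k\<^sup>2 T\<close>.  For the variation field \<open>\<alpha> T + \<beta> N\<close> the density
  \<open>\<bar>\<nabla>\<^sub>T\<nabla>\<^sub>T T\<bar>\<^sup>2 / 2\<close> has the derivative
  \<open>- k\<^sup>2 (\<alpha>''' - 3 k \<beta>'' - 3 k\<^sup>2 \<alpha>' + (k\<^sup>3 - 2 k C) \<beta>)\<close>.
  Hence criticality means \<open>f''' = 3 k\<^sup>2 f'\<close> and \<open>3 f'' = (k\<^sup>2 - 2 C) f\<close>.  Differentiating the
  second equation gives \<open>(8 k\<^sup>2 + 2 C) f' = 0\<close>.  If \<open>f'\<close> vanished identically, \<open>f\<close> would be
  constant and the curve 3-harmonic; so \<open>C = - 4 k\<^sup>2\<close>.  The equations are only needed near one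
  point with \<open>f' \<noteq> 0\<close>, and there variations that are affine in \<open>t\<close> in a single chart suffice.
\<close>

section \<open>Calculus of smooth functions\<close>

text \<open>The obstacle is that the geometry comes in coordinates: the connection is a definite
  description, and norms along a curve are taken in an arbitrarily selected chart. A computation in
  one chart is legitimate only once the Christoffel form is known to exist and to be smooth, and the
  field \<open>\<nabla>\<^sub>T\<nabla>\<^sub>T T\<close> is known to transform like a vector. The
  density formula rests on the fact that the undisturbed field is -k^2 T, so only the tangential
  part of its variation matters. The variation derivative has to be moved inward past two
  derivatives along the curve, because the Frenet equations hold only for the undisturbed curve.
  Each exchange produces a curvature term, and each of the two contributes -k C \<beta> to the
  tangential part; this is the origin of the coefficient 2 k C. The other coefficients are those of
  the rotating Frenet frame: (a, b) becomes (a' - k b, b' + k a) under differentiation, applied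
  three times.\<close>

lemma frechet_derivative_eqI: "(f has_derivative f') (at x) \<Longrightarrow> frechet_derivative f (at x) = f'"
  by (rule frechet_derivative_at[symmetric])

lemma has_derivative_frechet:
  "f differentiable (at x) \<Longrightarrow> (f has_derivative frechet_derivative f (at x)) (at x)"
  by (simp add: frechet_derivative_works)

section \<open>Calculus of finitely often differentiable functions\<close>

lemma Ck_on_mono: "Ck_on k S f \<Longrightarrow> T \<subseteq> S \<Longrightarrow> Ck_on k T f"
proof (induction k arbitrary: f)
  case 0
  then show ?case by (simp add: continuous_on_subset)
next
  case (Suc k)
  then show ?case by (simp add: subset_iff)
qed

lemma Ck_on_SucD: "Ck_on (Suc k) S f \<Longrightarrow> Ck_on k S f"
proof (induction k arbitrary: f)
  case 0
  then show ?case
    by (simp add: continuous_at_imp_continuous_on differentiable_imp_continuous_within)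
next
  case (Suc k)
  then show ?case by auto
qed

text \<open>Openness makes agreement on \<open>S\<close> agreement near each point of
  \<open>S\<close>, so the full-space derivatives agree on \<open>S\<close> as well and the
  induction can pass to them.\<close>

lemma Ck_on_cong:
  assumes "open S" "\<And>x. x \<in> S \<Longrightarrow> f x = g x" "Ck_on k S f"
  shows "Ck_on k S g"
  using assms(2,3)
proof (induction k arbitrary: f g)
  case 0
  then show ?case by (simp cong: continuous_on_cong)
next
  case (Suc k)
  have d: "(g has_derivative frechet_derivative f (at x)) (at x)" if "x \<in> S" for x
    using Suc.prems that \<open>open S\<close>
    by (auto intro!: has_derivative_transform_within_open[OF has_derivative_frechet])
  have "frechet_derivative f (at x) = frechet_derivative g (at x)" if "x \<in> S" for x
    using frechet_derivative_eqI[OF d[OF that]] by simp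
  with Suc.prems(2) have "Ck_on k S (\<lambda>x. frechet_derivative g (at x) v)" for v
    using Suc.IH[of "\<lambda>x. frechet_derivative f (at x) v" "\<lambda>x. frechet_derivative g (at x) v"] by simp
  with d show ?case by (auto simp: differentiable_def)
qed

text \<open>Serves for maps given by different formulas on overlapping open pieces, such as a
  variation that is affine inside a chart and constant in time elsewhere.\<close>

lemma Ck_on_local:
  assumes "\<And>x. x \<in> S \<Longrightarrow> \<exists>T. open T \<and> x \<in> T \<and> Ck_on k T f"
  shows "Ck_on k S f"
  using assms
proof (induction k arbitrary: f)
  case 0
  show ?case
    unfolding Ck_on.simps
  proof (rule continuous_at_imp_continuous_on, rule ballI)
    fix x assume "x \<in> S"
    with 0 obtain T where "open T" "x \<in> T" "continuous_on T f" by auto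
    then show "isCont f x" by (simp add: continuous_on_eq_continuous_at)
  qed
next
  case (Suc k)
  have "\<exists>T. open T \<and> x \<in> T \<and> Ck_on k T (\<lambda>x. frechet_derivative f (at x) v)" if "x \<in> S" for x v
    using Suc.prems[OF that] by auto
  then have "Ck_on k S (\<lambda>x. frechet_derivative f (at x) v)" for v by (rule Suc.IH)
  moreover have "f differentiable (at x)" if "x \<in> S" for x
    using Suc.prems[OF that] by auto
  ultimately show ?case by simp
qed

text \<open>Lets an explicit derivative stand in for the chosen \<open>frechet_derivative\<close>;
  the closure rules below are inductions through this rule.\<close>

lemma Ck_on_SucI:
  assumes "open S" "\<And>x. x \<in> S \<Longrightarrow> (f has_derivative f' x) (at x)"
    "\<And>v. Ck_on k S (\<lambda>x. f' x v)"
  shows "Ck_on (Suc k) S f"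
  unfolding Ck_on.simps
proof (intro conjI ballI allI)
  show "f differentiable (at x)" if "x \<in> S" for x
    using assms(2)[OF that] by (auto simp: differentiable_def)
  show "Ck_on k S (\<lambda>x. frechet_derivative f (at x) v)" for v
    by (rule Ck_on_cong[OF assms(1) _ assms(3)[of v]]) (simp add: frechet_derivative_eqI[OF assms(2)])
qed

lemma Ck_on_SucE:
  assumes "Ck_on (Suc k) S f" "x \<in> S"
  shows "(f has_derivative frechet_derivative f (at x)) (at x)"
  using assms by (intro has_derivative_frechet) simp

lemma Ck_on_const: "open S \<Longrightarrow> Ck_on k S (\<lambda>x. c)"
  by (induction k arbitrary: c) auto

lemma Ck_on_add: "open S \<Longrightarrow> Ck_on k S f \<Longrightarrow> Ck_on k S g \<Longrightarrow> Ck_on k S (\<lambda>x. f x + g x)"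
proof (induction k arbitrary: f g)
  case (Suc k)
  show ?case
    by (rule Ck_on_SucI[OF Suc.prems(1)])
      (auto intro!: has_derivative_add Ck_on_SucE[OF Suc.prems(2)] Ck_on_SucE[OF Suc.prems(3)]
        Suc.IH Suc.prems(1) simp: Suc.prems(2,3)[unfolded Ck_on.simps])
qed (auto intro: continuous_on_add)

lemma Ck_on_bounded_linear:
  assumes "bounded_linear h" "open S"
  shows "Ck_on k S f \<Longrightarrow> Ck_on k S (\<lambda>x. h (f x))"
proof (induction k arbitrary: f)
  case 0
  then show ?case by (auto intro: bounded_linear.continuous_on[OF assms(1)])
next
  case (Suc k)
  show ?case
    by (rule Ck_on_SucI[OF assms(2)])
      (auto intro!: bounded_linear.has_derivative[OF assms(1)] Ck_on_SucE[OF Suc.prems]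
        Suc.IH simp: Suc.prems[unfolded Ck_on.simps])
qed

lemma Ck_on_bounded_bilinear:
  assumes "bounded_bilinear B" "open S"
  shows "Ck_on k S f \<Longrightarrow> Ck_on k S g \<Longrightarrow> Ck_on k S (\<lambda>x. B (f x) (g x))"
proof (induction k arbitrary: f g)
  case 0
  then show ?case by (auto intro: bounded_bilinear.continuous_on[OF assms(1)])
next
  case (Suc k)
  show ?case
    by (rule Ck_on_SucI[OF assms(2) bounded_bilinear.FDERIV[OF assms(1)
          Ck_on_SucE[OF Suc.prems(1)] Ck_on_SucE[OF Suc.prems(2)]]])
      (use Suc.prems[THEN Ck_on_SucD] in \<open>auto intro!: Ck_on_add assms(2)
        Suc.IH simp: Suc.prems[unfolded Ck_on.simps]\<close>)
qed

lemma Ck_on_Pair: "open S \<Longrightarrow> Ck_on k S f \<Longrightarrow> Ck_on k S g \<Longrightarrow> Ck_on k S (\<lambda>x. (f x, g x))"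
proof (induction k arbitrary: f g)
  case (Suc k)
  show ?case
    by (rule Ck_on_SucI[OF Suc.prems(1)])
      (auto intro!: has_derivative_Pair Ck_on_SucE[OF Suc.prems(2)] Ck_on_SucE[OF Suc.prems(3)]
        Suc.IH Suc.prems(1) simp: Suc.prems(2,3)[unfolded Ck_on.simps])
qed (auto intro: continuous_on_Pair)

lemma Ck_on_sum:
  "open S \<Longrightarrow> (\<And>i. i \<in> A \<Longrightarrow> Ck_on k S (f i)) \<Longrightarrow> Ck_on k S (\<lambda>x. \<Sum>i\<in>A. f i x)"
  by (induction A rule: infinite_finite_induct) (auto intro: Ck_on_add Ck_on_const)

text \<open>In the chain rule the direction fed to the derivative of \<open>g\<close> varies with
  the point, while \<open>Ck_on\<close> speaks of fixed directions only. Expanding that direction in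
  the basis leaves products of components of f' with fixed partial derivatives of \<open>g\<close>,
  to which the induction hypothesis applies.\<close>

lemma Ck_on_compose:
  fixes f :: "'a::euclidean_space \<Rightarrow> 'b::euclidean_space"
  assumes "open S" "open T" "f ` S \<subseteq> T"
  shows "Ck_on k S f \<Longrightarrow> Ck_on k T g \<Longrightarrow> Ck_on k S (\<lambda>x. g (f x))"
proof (induction k arbitrary: g)
  case 0
  then show ?case using assms(3) by (auto intro: continuous_on_compose2)
next
  case (Suc k)
  have d: "((\<lambda>x. g (f x)) has_derivative
      (\<lambda>v. \<Sum>b\<in>Basis. (frechet_derivative f (at x) v \<bullet> b) *\<^sub>R frechet_derivative g (at (f x)) b)) (at x)"
    if x: "x \<in> S" for x
  proof -
    have fx: "f x \<in> T" using x assms(3) by auto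
    have g: "(g has_derivative frechet_derivative g (at (f x))) (at (f x))"
      by (rule Ck_on_SucE[OF Suc.prems(2) fx])
    interpret G: bounded_linear "frechet_derivative g (at (f x))"
      using g by (rule has_derivative_bounded_linear)
    have "frechet_derivative g (at (f x)) w =
        (\<Sum>b\<in>Basis. (w \<bullet> b) *\<^sub>R frechet_derivative g (at (f x)) b)" for w
      using arg_cong[OF euclidean_representation[of w], of "frechet_derivative g (at (f x))"]
      by (simp only: G.sum G.scaleR)
    then have "(\<lambda>v. frechet_derivative g (at (f x)) (frechet_derivative f (at x) v)) =
        (\<lambda>v. \<Sum>b\<in>Basis. (frechet_derivative f (at x) v \<bullet> b) *\<^sub>R frechet_derivative g (at (f x)) b)"
      by (intro ext)
    with has_derivative_compose[OF Ck_on_SucE[OF Suc.prems(1) x] g] show ?thesis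
      by (simp only:)
  qed
  show ?case
    by (rule Ck_on_SucI[OF assms(1) d])
      (auto intro!: Ck_on_sum Ck_on_bounded_bilinear[OF bounded_bilinear_scaleR] assms(1)
        Ck_on_bounded_linear[OF bounded_linear_inner_left] Suc.IH Ck_on_SucD[OF Suc.prems(1)]
        simp: Suc.prems[unfolded Ck_on.simps])
qed

text \<open>The derivative of \<open>inverse f\<close> is a product of \<open>inverse f\<close>, a
  derivative of \<open>f\<close> and \<open>inverse f\<close> again, so the induction closes on the
  same \<open>f\<close>.\<close>

lemma Ck_on_inverse:
  fixes f :: "'a::euclidean_space \<Rightarrow> real"
  assumes "open S" "\<And>x. x \<in> S \<Longrightarrow> f x \<noteq> 0"
  shows "Ck_on k S f \<Longrightarrow> Ck_on k S (\<lambda>x. inverse (f x))"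
proof (induction k)
  case 0
  then have "continuous_on S f" by simp
  then show ?case unfolding Ck_on.simps by (rule continuous_on_inverse) (simp add: assms(2))
next
  case (Suc k)
  show ?case
    by (rule Ck_on_SucI[OF assms(1) Deriv.has_derivative_inverse[OF assms(2) Ck_on_SucE[OF Suc.prems]]])
      (assumption | rule Ck_on_bounded_linear[OF bounded_linear_minus[OF bounded_linear_ident]] assms(1)
        Ck_on_bounded_bilinear[OF bounded_bilinear_mult] Suc.IH Ck_on_SucD[OF Suc.prems]
        Suc.prems[unfolded Ck_on.simps, THEN conjunct2, rule_format])+
qed

lemma smooth_on_mono: "smooth_on S f \<Longrightarrow> T \<subseteq> S \<Longrightarrow> smooth_on T f"
  unfolding smooth_on_def using Ck_on_mono by blast

lemma smooth_on_cong:
  "open S \<Longrightarrow> (\<And>x. x \<in> S \<Longrightarrow> f x = g x) \<Longrightarrow> smooth_on S f \<Longrightarrow> smooth_on S g"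
  unfolding smooth_on_def using Ck_on_cong[of S f g] by blast

lemma smooth_on_local:
  assumes "\<And>x. x \<in> S \<Longrightarrow> \<exists>T. open T \<and> x \<in> T \<and> smooth_on T f"
  shows "smooth_on S f"
  unfolding smooth_on_def
proof (intro allI Ck_on_local)
  show "\<exists>T. open T \<and> x \<in> T \<and> Ck_on k T f" if "x \<in> S" for x k
    using assms[OF that] unfolding smooth_on_def by blast
qed

lemma smooth_on_differentiable: "smooth_on S f \<Longrightarrow> x \<in> S \<Longrightarrow> f differentiable (at x)"
  unfolding smooth_on_def by (drule spec[of _ "Suc 0"]) simp

lemma smooth_on_has_derivative:
  "smooth_on S f \<Longrightarrow> x \<in> S \<Longrightarrow> (f has_derivative frechet_derivative f (at x)) (at x)"
  by (intro has_derivative_frechet smooth_on_differentiable)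

lemma smooth_on_frechet_derivative:
  "smooth_on S f \<Longrightarrow> smooth_on S (\<lambda>x. frechet_derivative f (at x) v)"
  unfolding smooth_on_def
proof
  assume "\<forall>k. Ck_on k S f"
  then have "Ck_on (Suc k) S f" for k by blast
  then show "Ck_on k S (\<lambda>x. frechet_derivative f (at x) v)" for k by simp
qed

lemma smooth_on_continuous_on: "smooth_on S f \<Longrightarrow> continuous_on S f"
  unfolding smooth_on_def by (drule spec[of _ 0]) simp

lemma smooth_on_const: "open S \<Longrightarrow> smooth_on S (\<lambda>x. c)"
  by (simp add: smooth_on_def Ck_on_const)

lemma smooth_on_add:
  "open S \<Longrightarrow> smooth_on S f \<Longrightarrow> smooth_on S g \<Longrightarrow> smooth_on S (\<lambda>x. f x + g x)"
  by (simp add: smooth_on_def Ck_on_add)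

lemma smooth_on_bounded_linear:
  "bounded_linear h \<Longrightarrow> open S \<Longrightarrow> smooth_on S f \<Longrightarrow> smooth_on S (\<lambda>x. h (f x))"
  by (simp add: smooth_on_def Ck_on_bounded_linear)

lemma smooth_on_bounded_bilinear:
  "bounded_bilinear B \<Longrightarrow> open S \<Longrightarrow> smooth_on S f \<Longrightarrow> smooth_on S g \<Longrightarrow>
    smooth_on S (\<lambda>x. B (f x) (g x))"
  by (simp add: smooth_on_def Ck_on_bounded_bilinear)

lemmas smooth_on_scaleR = smooth_on_bounded_bilinear[OF bounded_bilinear_scaleR]
lemmas smooth_on_mult = smooth_on_bounded_bilinear[OF bounded_bilinear_mult]
lemmas smooth_on_inner_left = smooth_on_bounded_linear[OF bounded_linear_inner_left]

lemma smooth_on_minus: "open S \<Longrightarrow> smooth_on S f \<Longrightarrow> smooth_on S (\<lambda>x. - f x)"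
  by (rule smooth_on_bounded_linear[OF bounded_linear_minus[OF bounded_linear_ident]])

lemma smooth_on_diff:
  "open S \<Longrightarrow> smooth_on S f \<Longrightarrow> smooth_on S g \<Longrightarrow> smooth_on S (\<lambda>x. f x - g x)"
  using smooth_on_add[of S f "\<lambda>x. - g x"] smooth_on_minus[of S g] by simp

lemma smooth_on_Pair:
  "open S \<Longrightarrow> smooth_on S f \<Longrightarrow> smooth_on S g \<Longrightarrow> smooth_on S (\<lambda>x. (f x, g x))"
  by (simp add: smooth_on_def Ck_on_Pair)

lemma smooth_on_sum:
  "open S \<Longrightarrow> (\<And>i. i \<in> A \<Longrightarrow> smooth_on S (f i)) \<Longrightarrow> smooth_on S (\<lambda>x. \<Sum>i\<in>A. f i x)"
  by (simp add: smooth_on_def Ck_on_sum)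

lemma smooth_on_inverse:
  fixes f :: "'a::euclidean_space \<Rightarrow> real"
  shows "open S \<Longrightarrow> (\<And>x. x \<in> S \<Longrightarrow> f x \<noteq> 0) \<Longrightarrow> smooth_on S f \<Longrightarrow> smooth_on S (\<lambda>x. inverse (f x))"
  by (simp add: smooth_on_def Ck_on_inverse)

lemma smooth_on_compose:
  fixes f :: "'a::euclidean_space \<Rightarrow> 'b::euclidean_space"
  shows "open S \<Longrightarrow> open T \<Longrightarrow> f ` S \<subseteq> T \<Longrightarrow> smooth_on S f \<Longrightarrow> smooth_on T g \<Longrightarrow>
    smooth_on S (\<lambda>x. g (f x))"
  by (simp add: smooth_on_def Ck_on_compose)

lemma smooth_onI_derivative:
  assumes "open S" "\<And>x. x \<in> S \<Longrightarrow> (f has_derivative f' x) (at x)"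
    "\<And>v. smooth_on S (\<lambda>x. f' x v)"
  shows "smooth_on S f"
  unfolding smooth_on_def
proof
  fix k
  have "Ck_on (Suc k) S f"
    by (rule Ck_on_SucI[OF assms(1,2)]) (use assms(3) in \<open>auto simp: smooth_on_def\<close>)
  then show "Ck_on k S f" by (rule Ck_on_SucD)
qed

lemma smooth_on_linear: "bounded_linear h \<Longrightarrow> open S \<Longrightarrow> smooth_on S h"
  by (rule smooth_onI_derivative[OF _ bounded_linear_imp_has_derivative])
    (simp_all add: smooth_on_const)

lemmas smooth_on_fst = smooth_on_linear[OF bounded_linear_fst]
lemmas smooth_on_snd = smooth_on_linear[OF bounded_linear_snd]
lemmas smooth_on_ident = smooth_on_linear[OF bounded_linear_ident]

section \<open>Symmetry of second derivatives\<close>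

lemma has_derivative_along_line:
  assumes "(g has_derivative D) (at (p + s *\<^sub>R u))"
  shows "((\<lambda>s. g (p + s *\<^sub>R u)) has_real_derivative D u) (at s)"
proof -
  interpret bounded_linear D using assms by (rule has_derivative_bounded_linear)
  have "((\<lambda>s. p + s *\<^sub>R u) has_derivative (\<lambda>k. k *\<^sub>R u)) (at s)"
    by (auto intro!: derivative_eq_intros)
  from has_derivative_compose[OF this assms] show ?thesis
    by (simp add: has_field_derivative_def scaleR mult.commute[of _ "D u"])
qed

text \<open>Two applications of the mean value theorem to the second difference over a
  parallelogram; the bound on \<open>h\<close> keeps the whole parallelogram in the ball.\<close>

lemma second_difference_mean_value:
  fixes g :: "'a::euclidean_space \<Rightarrow> real"
  assumes g: "smooth_on (ball x r) g" and h: "h > 0" "h * norm u + h * norm v < r"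
  shows "\<exists>y\<in>ball x r. g (x + h *\<^sub>R u + h *\<^sub>R v) - g (x + h *\<^sub>R u) - g (x + h *\<^sub>R v) + g x =
    h * h * frechet_derivative (\<lambda>y. frechet_derivative g (at y) u) (at y) v"
proof -
  have in_ball: "x + s *\<^sub>R u + t *\<^sub>R v \<in> ball x r" if "0 \<le> s" "s \<le> h" "0 \<le> t" "t \<le> h" for s t
  proof -
    have "norm (s *\<^sub>R u + t *\<^sub>R v) \<le> s * norm u + t * norm v"
      using norm_triangle_ineq[of "s *\<^sub>R u" "t *\<^sub>R v"] that by simp
    also have "\<dots> \<le> h * norm u + h * norm v"
      using that by (intro add_mono mult_right_mono) auto
    finally have "norm (s *\<^sub>R u + t *\<^sub>R v) < r" using h(2) by linarith
    moreover have "dist x (x + s *\<^sub>R u + t *\<^sub>R v) = norm (s *\<^sub>R u + t *\<^sub>R v)"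
      by (subst dist_commute) (simp add: dist_norm add.assoc)
    ultimately show ?thesis by (simp only: mem_ball)
  qed
  define F where "F s = g (x + h *\<^sub>R v + s *\<^sub>R u) - g (x + s *\<^sub>R u)" for s
  define F' where "F' s = frechet_derivative g (at (x + h *\<^sub>R v + s *\<^sub>R u)) u
    - frechet_derivative g (at (x + s *\<^sub>R u)) u" for s
  have "(F has_real_derivative F' s) (at s)" if "0 \<le> s" "s \<le> h" for s
    unfolding F_def F'_def using in_ball[OF that, of h] in_ball[OF that, of 0] h(1)
    by (intro DERIV_diff has_derivative_along_line smooth_on_has_derivative[OF g])
      (simp_all add: algebra_simps)
  from MVT2[OF h(1) this] obtain z where z: "0 < z" "z < h" "F h - F 0 = h * F' z" by auto
  \<comment> \<open>The first application has fixed the position \<open>z\<close> in direction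
    \<open>u\<close>. What remains is a difference of u-derivatives at the two ends of a segment in
    direction \<open>v\<close>.\<close>
  define H where "H t = frechet_derivative g (at (x + z *\<^sub>R u + t *\<^sub>R v)) u" for t
  define H' where "H' t = frechet_derivative (\<lambda>y. frechet_derivative g (at y) u)
    (at (x + z *\<^sub>R u + t *\<^sub>R v)) v" for t
  have "(H has_real_derivative H' t) (at t)" if "0 \<le> t" "t \<le> h" for t
    unfolding H_def H'_def using in_ball[of z t] that z
    by (intro has_derivative_along_line[OF smooth_on_has_derivative[OF smooth_on_frechet_derivative[OF g]]])
      auto
  from MVT2[OF h(1) this] obtain t where t: "0 < t" "t < h" "H h - H 0 = h * H' t" by auto
  have "F' z = H h - H 0" by (simp add: F'_def H_def algebra_simps)
  with z t have "F h - F 0 = h * h * H' t" by simp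
  then show ?thesis
    using in_ball[of z t] z t unfolding H'_def
    by (intro bexI[of _ "x + z *\<^sub>R u + t *\<^sub>R v"]) (auto simp: F_def algebra_simps)
qed

text \<open>The second difference is symmetric in \<open>u\<close> and \<open>v\<close>, so both
  mixed derivatives take a common value at points arbitrarily near \<open>x\<close>. By continuity
  each is within half of the supposed gap of its value at \<open>x\<close>, which is too close for a
  gap.\<close>

lemma frechet_derivative_commute_real:
  fixes g :: "'a::euclidean_space \<Rightarrow> real"
  assumes S: "open S" and g: "smooth_on S g" and x: "x \<in> S"
  shows "frechet_derivative (\<lambda>y. frechet_derivative g (at y) u) (at x) v =
    frechet_derivative (\<lambda>y. frechet_derivative g (at y) v) (at x) u"
proof (rule ccontr)
  define D where "D u v y = frechet_derivative (\<lambda>y. frechet_derivative g (at y) u) (at y) v" for u v y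
  assume "\<not> ?thesis"
  then have e: "\<bar>D u v x - D v u x\<bar> / 2 > 0" (is "?e > 0") by (simp add: D_def)
  have "continuous_on S (D u v)" for u v
    unfolding D_def
    by (intro smooth_on_continuous_on smooth_on_frechet_derivative g)
  then have cont: "isCont (D u v) x" for u v
    using S x by (simp add: continuous_on_eq_continuous_at)
  obtain r1 where r1: "r1 > 0" "ball x r1 \<subseteq> S" using S x openE by blast
  obtain r2 where r2: "r2 > 0" "\<And>y. dist y x < r2 \<Longrightarrow> dist (D u v y) (D u v x) < ?e"
    using cont[of u v] e unfolding continuous_at_eps_delta by metis
  obtain r3 where r3: "r3 > 0" "\<And>y. dist y x < r3 \<Longrightarrow> dist (D v u y) (D v u x) < ?e"
    using cont[of v u] e unfolding continuous_at_eps_delta by metis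
  define r where "r = min r1 (min r2 r3)"
  have r: "r > 0" using r1 r2 r3 by (simp add: r_def)
  have gr: "smooth_on (ball x r) g"
    by (rule smooth_on_mono[OF g]) (use r1 in \<open>auto simp: r_def\<close>)
  \<comment> \<open>The summand 1 keeps the denominator positive even if both directions
    vanish.\<close>
  define h where "h = r / (2 * (norm u + norm v + 1))"
  have h: "h > 0" using r by (auto simp: h_def intro!: divide_pos_pos add_nonneg_pos)
  have "h * norm u + h * norm v < h * (2 * (norm u + norm v + 1))"
    unfolding distrib_left[symmetric] using h
    by (intro mult_strict_left_mono) (auto intro!: add_nonneg_pos simp: less_eq_real_def)
  also have "\<dots> = r"
    unfolding h_def using add_nonneg_pos[OF add_nonneg_nonneg[OF norm_ge_zero[of u] norm_ge_zero[of v]] zero_less_one]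
    by simp
  finally have hr: "h * norm u + h * norm v < r" .
  then have hr': "h * norm v + h * norm u < r" by simp
  obtain y where y: "y \<in> ball x r" 
    "g (x + h *\<^sub>R u + h *\<^sub>R v) - g (x + h *\<^sub>R u) - g (x + h *\<^sub>R v) + g x = h * h * D u v y"
    using second_difference_mean_value[OF gr h hr] unfolding D_def by blast
  obtain z where z: "z \<in> ball x r" 
    "g (x + h *\<^sub>R v + h *\<^sub>R u) - g (x + h *\<^sub>R v) - g (x + h *\<^sub>R u) + g x = h * h * D v u z"
    using second_difference_mean_value[OF gr h hr'] unfolding D_def by blast
  have sw: "x + h *\<^sub>R v + h *\<^sub>R u = x + h *\<^sub>R u + h *\<^sub>R v" by (simp add: algebra_simps)
  have "h * h * D u v y = h * h * D v u z" using y(2) z(2) unfolding sw by linarith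
  then have "D u v y = D v u z" using h by simp
  moreover have "\<bar>D u v y - D u v x\<bar> < ?e" "\<bar>D v u z - D v u x\<bar> < ?e"
    using r2(2)[of y] r3(2)[of z] y(1)[unfolded mem_ball dist_commute[of x]]
      z(1)[unfolded mem_ball dist_commute[of x]] by (auto simp: r_def dist_real_def)
  ultimately have "\<bar>D u v x - D v u x\<bar> < ?e + ?e"
    using dist_triangle3[of "D u v x" "D v u x" "D u v y"] unfolding dist_real_def by simp
  then show False by simp
qed

lemma frechet_derivative_inner_left:
  "f differentiable (at x) \<Longrightarrow>
    frechet_derivative (\<lambda>y. f y \<bullet> b) (at x) u = frechet_derivative f (at x) u \<bullet> b"
  using frechet_derivative_eqI[OF has_derivative_inner_left[OF has_derivative_frechet]] by metis

lemma frechet_derivative_cong: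
  assumes "open S" "\<And>y. y \<in> S \<Longrightarrow> f y = g y" "x \<in> S" "f differentiable (at x)"
  shows "frechet_derivative g (at x) = frechet_derivative f (at x)"
  using assms
  by (intro frechet_derivative_eqI has_derivative_transform_within_open[OF has_derivative_frechet])

lemma frechet_derivative_commute:
  fixes g :: "'a::euclidean_space \<Rightarrow> 'b::euclidean_space"
  assumes S: "open S" and g: "smooth_on S g" and x: "x \<in> S"
  shows "frechet_derivative (\<lambda>y. frechet_derivative g (at y) u) (at x) v =
    frechet_derivative (\<lambda>y. frechet_derivative g (at y) v) (at x) u"
proof (rule euclidean_eqI)
  fix b :: 'b assume "b \<in> Basis"
  have "frechet_derivative (\<lambda>y. frechet_derivative g (at y) u) (at x) v \<bullet> b =
      frechet_derivative (\<lambda>y. frechet_derivative (\<lambda>z. g z \<bullet> b) (at y) u) (at x) v" for u v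
  proof -
    have s: "smooth_on S (\<lambda>y. frechet_derivative g (at y) u \<bullet> b)"
      by (intro smooth_on_inner_left S smooth_on_frechet_derivative g)
    have "frechet_derivative (\<lambda>y. frechet_derivative g (at y) u) (at x) v \<bullet> b =
        frechet_derivative (\<lambda>y. frechet_derivative g (at y) u \<bullet> b) (at x) v"
      by (rule frechet_derivative_inner_left[symmetric])
        (rule smooth_on_differentiable[OF smooth_on_frechet_derivative[OF g] x])
    also have "\<dots> = frechet_derivative (\<lambda>y. frechet_derivative (\<lambda>z. g z \<bullet> b) (at y) u) (at x) v"
      by (subst frechet_derivative_cong[OF S _ x smooth_on_differentiable[OF s x]])
        (auto simp: frechet_derivative_inner_left[OF smooth_on_differentiable[OF g]])
    finally show ?thesis .
  qed
  with frechet_derivative_commute_real[OF S smooth_on_inner_left[OF S g] x]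
  show "frechet_derivative (\<lambda>y. frechet_derivative g (at y) u) (at x) v \<bullet> b =
    frechet_derivative (\<lambda>y. frechet_derivative g (at y) v) (at x) u \<bullet> b" by simp
qed

section \<open>Smooth families of bilinear maps\<close>

text \<open>Metrics and Christoffel forms are both of this kind. Smoothness is asked for fixed
  arguments only; in finite dimension this already gives smoothness with moving arguments.\<close>

definition smooth_bilinear_on ::
  "'e::euclidean_space set \<Rightarrow> ('e \<Rightarrow> 'e \<Rightarrow> 'e \<Rightarrow> 'b::real_normed_vector) \<Rightarrow> bool" where
  "smooth_bilinear_on U G \<longleftrightarrow>
     open U \<and> (\<forall>x\<in>U. bilinear (G x)) \<and> (\<forall>u v. smooth_on U (\<lambda>x. G x u v))"

definition dbilin ::
  "('e::euclidean_space \<Rightarrow> 'e \<Rightarrow> 'e \<Rightarrow> 'b::real_normed_vector) \<Rightarrow> 'e \<Rightarrow> 'e \<Rightarrow> 'e \<Rightarrow> 'e \<Rightarrow> 'b" where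
  "dbilin G x w u v = frechet_derivative (\<lambda>z. G z u v) (at x) w"

lemma bilinear_expand:
  fixes B :: "'e::euclidean_space \<Rightarrow> 'e \<Rightarrow> 'b::real_normed_vector"
  assumes "bilinear B"
  shows "B u v = (\<Sum>i\<in>Basis. \<Sum>j\<in>Basis. ((u \<bullet> i) * (v \<bullet> j)) *\<^sub>R B i j)"
proof -
  have "B u v = B (\<Sum>i\<in>Basis. (u \<bullet> i) *\<^sub>R i) (\<Sum>j\<in>Basis. (v \<bullet> j) *\<^sub>R j)"
    by (simp add: euclidean_representation)
  also have "\<dots> = (\<Sum>i\<in>Basis. \<Sum>j\<in>Basis. ((u \<bullet> i) * (v \<bullet> j)) *\<^sub>R B i j)"
    by (simp add: bilinear_sum[OF assms] sum.cartesian_product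
        bilinear_lmul[OF assms] bilinear_rmul[OF assms] mult.commute)
  finally show ?thesis .
qed

lemma smooth_bilinear_on_bilinear: "smooth_bilinear_on U G \<Longrightarrow> x \<in> U \<Longrightarrow> bilinear (G x)"
  by (simp add: smooth_bilinear_on_def)

lemma smooth_bilinear_on_has_derivative:
  "smooth_bilinear_on U G \<Longrightarrow> x \<in> U \<Longrightarrow>
    ((\<lambda>z. G z u v) has_derivative (\<lambda>w. dbilin G x w u v)) (at x)"
  unfolding smooth_bilinear_on_def dbilin_def by (blast intro: smooth_on_has_derivative)

text \<open>The identities expressing bilinearity hold on an open set, hence may be differentiated
  in the base point.\<close>

lemma bilinear_dbilin:
  assumes G: "smooth_bilinear_on U G" and x: "x \<in> U"
  shows "bilinear (dbilin G x w)"
proof -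
  have U: "open U" using G by (simp add: smooth_bilinear_on_def)
  note b = smooth_bilinear_on_bilinear[OF G]
  note d = smooth_bilinear_on_has_derivative[OF G x]
  have eq: "dbilin G x w u v = D w"
    if "(F has_derivative D) (at x)" "\<And>z. z \<in> U \<Longrightarrow> F z = G z u v" for F D u v
    unfolding dbilin_def
    by (rule fun_cong[OF frechet_derivative_eqI[OF has_derivative_transform_within_open[OF that(1) U x that(2)]]])
  show ?thesis
    unfolding bilinear_def
    by (intro conjI allI linearI; (rule eq[OF has_derivative_add[OF d d]] | rule eq[OF has_derivative_scaleR_right[OF d]]))
      (simp_all add: bilinear_ladd[OF b] bilinear_radd[OF b] bilinear_lmul[OF b] bilinear_rmul[OF b])
qed

text \<open>A product rule with three factors: base point, first and second argument. The basis
  expansion turns moving arguments into scalar coefficients of fixed ones; after differentiation the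
  sums are folded back.\<close>

lemma smooth_bilinear_on_compose_has_derivative:
  fixes y a b :: "'d::euclidean_space \<Rightarrow> 'e::euclidean_space"
  assumes G: "smooth_bilinear_on U G" and y: "(y has_derivative y') (at p)" "y p \<in> U"
    and a: "(a has_derivative a') (at p)" and b: "(b has_derivative b') (at p)"
  shows "((\<lambda>q. G (y q) (a q) (b q)) has_derivative
    (\<lambda>h. dbilin G (y p) (y' h) (a p) (b p) + G (y p) (a' h) (b p) + G (y p) (a p) (b' h))) (at p)"
proof -
  have U: "open U" using G by (simp add: smooth_bilinear_on_def)
  note bil = smooth_bilinear_on_bilinear[OF G]
  have ev: "\<forall>\<^sub>F q in at p. y q \<in> U"
    using has_derivative_continuous[OF y(1)] U y(2)
    by (metis continuous_within topological_tendstoD)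
  have "((\<lambda>q. \<Sum>i\<in>Basis. \<Sum>j\<in>Basis. ((a q \<bullet> i) * (b q \<bullet> j)) *\<^sub>R G (y q) i j) has_derivative
     (\<lambda>h. \<Sum>i\<in>Basis. \<Sum>j\<in>Basis. ((a p \<bullet> i) * (b p \<bullet> j)) *\<^sub>R dbilin G (y p) (y' h) i j
        + ((a p \<bullet> i) * (b' h \<bullet> j) + (a' h \<bullet> i) * (b p \<bullet> j)) *\<^sub>R G (y p) i j)) (at p)"
    by (intro has_derivative_sum has_derivative_scaleR has_derivative_mult has_derivative_inner_left a b
        has_derivative_compose[OF y(1) smooth_bilinear_on_has_derivative[OF G y(2)]])
  also have "(\<lambda>h. \<Sum>i\<in>Basis. \<Sum>j\<in>Basis. ((a p \<bullet> i) * (b p \<bullet> j)) *\<^sub>R dbilin G (y p) (y' h) i j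
        + ((a p \<bullet> i) * (b' h \<bullet> j) + (a' h \<bullet> i) * (b p \<bullet> j)) *\<^sub>R G (y p) i j) =
     (\<lambda>h. dbilin G (y p) (y' h) (a p) (b p) + G (y p) (a' h) (b p) + G (y p) (a p) (b' h))"
    by (rule ext) (simp add: sum.distrib scaleR_add_left add_ac
      flip: bilinear_expand[OF bil[OF y(2)]] bilinear_expand[OF bilinear_dbilin[OF G y(2)]])
  finally show ?thesis
    by (rule has_derivative_transform_eventually)
      (use ev y(2) in \<open>auto elim!: eventually_mono simp: bilinear_expand[OF bil, symmetric]\<close>)
qed

lemma smooth_bilinear_on_compose:
  fixes y a b :: "'d::euclidean_space \<Rightarrow> 'e::euclidean_space"
  assumes G: "smooth_bilinear_on U G" and S: "open S" and y: "smooth_on S y" "y ` S \<subseteq> U"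
    and a: "smooth_on S a" and b: "smooth_on S b"
  shows "smooth_on S (\<lambda>q. G (y q) (a q) (b q))"
proof (rule smooth_on_cong[OF S])
  have U: "open U" and sm: "smooth_on U (\<lambda>x. G x u v)" for u v
    using G by (auto simp: smooth_bilinear_on_def)
  show "smooth_on S (\<lambda>q. \<Sum>i\<in>Basis. \<Sum>j\<in>Basis. ((a q \<bullet> i) * (b q \<bullet> j)) *\<^sub>R G (y q) i j)"
    by (intro smooth_on_sum smooth_on_scaleR smooth_on_mult smooth_on_inner_left S a b
        smooth_on_compose[OF S U y(2,1) sm])
  show "(\<Sum>i\<in>Basis. \<Sum>j\<in>Basis. ((a q \<bullet> i) * (b q \<bullet> j)) *\<^sub>R G (y q) i j) = G (y q) (a q) (b q)"
    if "q \<in> S" for q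
    using y(2) that by (auto intro!: bilinear_expand[symmetric] smooth_bilinear_on_bilinear[OF G])
qed

section \<open>Connections in local coordinates\<close>

text \<open>
  The covariant derivative, in the direction \<open>e\<close> of the parameter space, of a field \<open>Z\<close> along
  a map \<open>y\<close>, with respect to the Christoffel form \<open>G\<close>.
\<close>

definition cov ::
  "('e::euclidean_space \<Rightarrow> 'e \<Rightarrow> 'e \<Rightarrow> 'e) \<Rightarrow> ('d::euclidean_space \<Rightarrow> 'e) \<Rightarrow> 'd \<Rightarrow> ('d \<Rightarrow> 'e) \<Rightarrow> 'd \<Rightarrow> 'e" where
  "cov G y e Z p = frechet_derivative Z (at p) e + G (y p) (frechet_derivative y (at p) e) (Z p)"

text \<open>For \<open>G = christoffel M c\<close> this unfolds to
  \<open>curvature_tensor M c\<close>, with the same sign convention.\<close>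

definition curv ::
  "('e::euclidean_space \<Rightarrow> 'e \<Rightarrow> 'e \<Rightarrow> 'e) \<Rightarrow> 'e \<Rightarrow> 'e \<Rightarrow> 'e \<Rightarrow> 'e \<Rightarrow> 'e" where
  "curv G x u v w = dbilin G x u v w - dbilin G x v u w + G x u (G x v w) - G x v (G x u w)"

lemma cov_cong:
  assumes "open S" "\<And>q. q \<in> S \<Longrightarrow> Z q = W q" "p \<in> S" "Z differentiable (at p)"
  shows "cov G y e W p = cov G y e Z p"
  using frechet_derivative_cong[OF assms] assms(2,3) by (simp add: cov_def)

lemma frechet_derivative_slice:
  assumes "Z differentiable (at (t, s))"
  shows "frechet_derivative (\<lambda>s. Z (t, s)) (at s) e = frechet_derivative Z (at (t, s)) (0, e)"
proof -
  have "((\<lambda>s. (t, s)) has_derivative (\<lambda>h. (0, h))) (at s)"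
    by (auto intro!: derivative_eq_intros)
  from has_derivative_compose[OF this has_derivative_frechet[OF assms]] show ?thesis
    by (simp add: frechet_derivative_eqI)
qed

text \<open>Connects the two-parameter calculus, in which derivatives in different directions can be
  exchanged, with the covariant derivative along a single curve of the family.\<close>

lemma cov_slice:
  assumes "Z differentiable (at (t, s))" "y differentiable (at (t, s))"
  shows "cov G (\<lambda>s. y (t, s)) e (\<lambda>s. Z (t, s)) s = cov G y (0, e) Z (t, s)"
  unfolding cov_def by (simp add: frechet_derivative_slice assms)

text \<open>A connection on a coordinate domain; symmetry of \<open>G\<close> says that its torsion
  vanishes. The metric enters only in the extension below.\<close>

locale connection_chart =
  fixes U :: "'e::euclidean_space set" and G :: "'e \<Rightarrow> 'e \<Rightarrow> 'e \<Rightarrow> 'e"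
  assumes smooth: "smooth_bilinear_on U G"
    and sym: "x \<in> U \<Longrightarrow> G x u v = G x v u"
begin

lemma open_U: "open U"
  using smooth by (simp add: smooth_bilinear_on_def)

lemma bil: "x \<in> U \<Longrightarrow> bilinear (G x)"
  using smooth by (simp add: smooth_bilinear_on_def)

lemma smooth_on_cov:
  assumes "open P" "smooth_on P y" "y ` P \<subseteq> U" "smooth_on P Z"
  shows "smooth_on P (cov G y e Z)"
  unfolding cov_def
  by (intro smooth_on_add smooth_on_frechet_derivative smooth_bilinear_on_compose[OF smooth] assms)

lemma frechet_derivative_cov:
  assumes P: "open P" "p \<in> P" and y: "smooth_on P y" "y ` P \<subseteq> U" and Z: "smooth_on P Z"
  shows "frechet_derivative (cov G y e Z) (at p) d =
    frechet_derivative (\<lambda>q. frechet_derivative Z (at q) e) (at p) d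
    + dbilin G (y p) (frechet_derivative y (at p) d) (frechet_derivative y (at p) e) (Z p)
    + G (y p) (frechet_derivative (\<lambda>q. frechet_derivative y (at q) e) (at p) d) (Z p)
    + G (y p) (frechet_derivative y (at p) e) (frechet_derivative Z (at p) d)"
proof -
  have "(cov G y e Z has_derivative (\<lambda>d. frechet_derivative (\<lambda>q. frechet_derivative Z (at q) e) (at p) d
    + (dbilin G (y p) (frechet_derivative y (at p) d) (frechet_derivative y (at p) e) (Z p)
    + G (y p) (frechet_derivative (\<lambda>q. frechet_derivative y (at q) e) (at p) d) (Z p)
    + G (y p) (frechet_derivative y (at p) e) (frechet_derivative Z (at p) d)))) (at p)"
    unfolding cov_def
    by (intro has_derivative_add smooth_bilinear_on_compose_has_derivative[OF smooth]
        smooth_on_has_derivative[of P] smooth_on_frechet_derivative P y Z)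
      (use y P in auto)
  then show ?thesis by (simp add: frechet_derivative_eqI add.assoc)
qed

text \<open>The Ricci identity. The parameter directions are constant, so there is no bracket term,
  and the second derivatives of \<open>Z\<close> and of \<open>y\<close> cancel by symmetry.\<close>

lemma cov_commute:
  assumes P: "open P" "p \<in> P" and y: "smooth_on P y" "y ` P \<subseteq> U" and Z: "smooth_on P Z"
  shows "cov G y d (cov G y e Z) p = cov G y e (cov G y d Z) p
    + curv G (y p) (frechet_derivative y (at p) d) (frechet_derivative y (at p) e) (Z p)"
proof -
  have yp: "y p \<in> U" using P y by auto
  have exp: "cov G y d (cov G y e Z) p = frechet_derivative (cov G y e Z) (at p) d
    + (G (y p) (frechet_derivative y (at p) d) (frechet_derivative Z (at p) e)
    + G (y p) (frechet_derivative y (at p) d) (G (y p) (frechet_derivative y (at p) e) (Z p)))" for d e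
    by (subst cov_def) (simp add: cov_def[of _ _ e] bilinear_radd[OF bil[OF yp]])
  show ?thesis
    unfolding exp frechet_derivative_cov[OF P y Z] curv_def
    by (simp add: frechet_derivative_commute[OF P(1) Z P(2), of e]
        frechet_derivative_commute[OF P(1) y(1) P(2), of e] algebra_simps)
qed

text \<open>Vanishing torsion: both the mixed second derivative of \<open>y\<close> and the
  Christoffel form are symmetric.\<close>

lemma cov_torsion:
  assumes P: "open P" "p \<in> P" and y: "smooth_on P y" "y ` P \<subseteq> U"
  shows "cov G y d (\<lambda>q. frechet_derivative y (at q) e) p =
    cov G y e (\<lambda>q. frechet_derivative y (at q) d) p"
  using y(2) P sym
  by (auto simp: cov_def frechet_derivative_commute[OF P(1) y(1) P(2), of e])

lemma cov_scaleR:
  assumes "y p \<in> U" "a differentiable (at p)" "Z differentiable (at p)"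
  shows "cov G y e (\<lambda>q. a q *\<^sub>R Z q) p =
    a p *\<^sub>R cov G y e Z p + frechet_derivative a (at p) e *\<^sub>R Z p"
proof -
  have "frechet_derivative (\<lambda>q. a q *\<^sub>R Z q) (at p) =
     (\<lambda>h. a p *\<^sub>R frechet_derivative Z (at p) h + frechet_derivative a (at p) h *\<^sub>R Z p)"
    by (intro frechet_derivative_eqI has_derivative_scaleR has_derivative_frechet assms)
  then show ?thesis
    by (simp add: cov_def bilinear_rmul[OF bil[OF assms(1)]] algebra_simps)
qed

lemma cov_add:
  assumes "y p \<in> U" "Y differentiable (at p)" "Z differentiable (at p)"
  shows "cov G y e (\<lambda>q. Y q + Z q) p = cov G y e Y p + cov G y e Z p"
proof -
  have "frechet_derivative (\<lambda>q. Y q + Z q) (at p) =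
     (\<lambda>h. frechet_derivative Y (at p) h + frechet_derivative Z (at p) h)"
    by (intro frechet_derivative_eqI has_derivative_add has_derivative_frechet assms)
  then show ?thesis
    by (simp add: cov_def bilinear_radd[OF bil[OF assms(1)]] algebra_simps)
qed

lemma curv_antisym: "curv G x u v w = - curv G x v u w"
  by (simp add: curv_def)

lemma linear_curv:
  assumes "x \<in> U"
  shows "linear (\<lambda>u. curv G x u v w)" "linear (curv G x u v)"
proof -
  note b = bil[OF assms] and d = bilinear_dbilin[OF smooth assms]
  have l: "linear (\<lambda>h. dbilin G x h a b)" for a b
    using smooth_bilinear_on_has_derivative[OF smooth assms] has_derivative_linear by blast
  show "linear (\<lambda>u. curv G x u v w)" "linear (curv G x u v)"
    by (rule linearI; simp add: curv_def linear_add[OF l] linear_cmul[OF l] bilinear_ladd[OF d]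
        bilinear_radd[OF d] bilinear_lmul[OF d] bilinear_rmul[OF d] bilinear_ladd[OF b]
        bilinear_radd[OF b] bilinear_lmul[OF b] bilinear_rmul[OF b] algebra_simps)+
qed

text \<open>The linearized tension is the Jacobi operator of the variation field: one exchange by
  the Ricci identity, which leaves the curvature term, and one by vanishing torsion.\<close>

lemma cov_variation_tension:
  assumes P: "open P" "p \<in> P" and y: "smooth_on P y" "y ` P \<subseteq> U"
  shows "cov G y t (cov G y s (\<lambda>q. frechet_derivative y (at q) s)) p =
    cov G y s (cov G y s (\<lambda>q. frechet_derivative y (at q) t)) p
    + curv G (y p) (frechet_derivative y (at p) t) (frechet_derivative y (at p) s)
        (frechet_derivative y (at p) s)"
proof -
  let ?S = "\<lambda>q. frechet_derivative y (at q) s" and ?T = "\<lambda>q. frechet_derivative y (at q) t"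
  have S: "smooth_on P ?S" and T: "smooth_on P ?T"
    by (intro smooth_on_frechet_derivative y)+
  have "cov G y s (cov G y t ?S) p = cov G y s (cov G y s ?T) p"
    by (rule cov_cong[OF P(1) _ P(2)])
      (auto intro: cov_torsion[OF P(1) _ y] smooth_on_differentiable[OF smooth_on_cov[OF P(1) y T] P(2)])
  with cov_commute[OF P y S, of t s] show ?thesis by simp
qed

text \<open>Reduces covariant differentiation along the curve to scalar calculus in the Frenet
  frame.\<close>

lemma cov_frame:
  fixes x :: "real \<Rightarrow> 'e"
  assumes "x s \<in> U" "T differentiable (at s)" "N differentiable (at s)"
    and "(a has_real_derivative a') (at s)" "(b has_real_derivative b') (at s)"
    and "cov G x 1 T s = k *\<^sub>R N s" "cov G x 1 N s = - k *\<^sub>R T s"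
  shows "cov G x 1 (\<lambda>s. a s *\<^sub>R T s + b s *\<^sub>R N s) s =
    (a' - k * b s) *\<^sub>R T s + (b' + k * a s) *\<^sub>R N s"
proof -
  have a: "(a has_derivative (*) a') (at s)" and b: "(b has_derivative (*) b') (at s)"
    using assms(4,5) by (simp_all add: has_field_derivative_def)
  then have d: "a differentiable (at s)" "b differentiable (at s)" by (auto simp: differentiable_def)
  show ?thesis
    by (simp add: cov_add cov_scaleR differentiable_scaleR d assms(1-3,6,7) frechet_derivative_eqI[OF a]
        frechet_derivative_eqI[OF b] algebra_simps)
qed

end

text \<open>The Koszul formula is the only link between connection and metric; compatibility is
  derived from it where needed.\<close>

locale metric_chart = connection_chart U G
  for U :: "'e::euclidean_space set" and G :: "'e \<Rightarrow> 'e \<Rightarrow> 'e \<Rightarrow> 'e" +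
  fixes g :: "'e \<Rightarrow> 'e \<Rightarrow> 'e \<Rightarrow> real"
  assumes smooth_metric: "smooth_bilinear_on U g"
    and sym_metric: "x \<in> U \<Longrightarrow> g x u v = g x v u"
    and pos_def: "x \<in> U \<Longrightarrow> u \<noteq> 0 \<Longrightarrow> g x u u > 0"
    and koszul: "x \<in> U \<Longrightarrow>
      2 * g x (G x u v) z = dbilin g x u v z + dbilin g x v u z - dbilin g x z u v"
begin

text \<open>Metric compatibility on the diagonal: with both remaining slots equal to
  \<open>B\<close>, two terms of the Koszul formula cancel and 2 g(G(u, B), B) is the derivative of
  the metric coefficient in direction \<open>u\<close>.\<close>

lemma has_derivative_norm_square:
  fixes y :: "'d::euclidean_space \<Rightarrow> 'e"
  assumes "y differentiable (at p)" "y p \<in> U" "B differentiable (at p)"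
  shows "((\<lambda>q. g (y q) (B q) (B q)) has_derivative (\<lambda>e. 2 * g (y p) (cov G y e B p) (B p))) (at p)"
proof -
  note b = smooth_bilinear_on_bilinear[OF smooth_metric assms(2)]
  have "(\<lambda>h. dbilin g (y p) (frechet_derivative y (at p) h) (B p) (B p)
      + g (y p) (frechet_derivative B (at p) h) (B p) + g (y p) (B p) (frechet_derivative B (at p) h))
    = (\<lambda>e. 2 * g (y p) (cov G y e B p) (B p))"
    using koszul[OF assms(2), of _ "B p" "B p"] sym_metric[OF assms(2), of "B p"]
    by (intro ext) (simp add: cov_def bilinear_ladd[OF b] algebra_simps)
  then show ?thesis
    using smooth_bilinear_on_compose_has_derivative[OF smooth_metric
        has_derivative_frechet[OF assms(1)] assms(2) has_derivative_frechet[OF assms(3)]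
        has_derivative_frechet[OF assms(3)]] by simp
qed

text \<open>Dependent vectors have Gram determinant 0. The hypothesis on sectional curvature thus
  becomes applicable to pairs known only by their inner products.\<close>

lemma gram_independent:
  assumes x: "x \<in> U" and gram: "g x u u * g x v v - (g x u v)\<^sup>2 \<noteq> 0"
  shows "u \<noteq> v \<and> independent {u, v}"
proof -
  note b = smooth_bilinear_on_bilinear[OF smooth_metric x]
  have "v \<noteq> 0" using gram by (auto simp: bilinear_rzero[OF b])
  moreover have "u \<notin> span {v}"
    using gram by (auto simp: span_singleton bilinear_lmul[OF b] bilinear_rmul[OF b] power2_eq_square)
  ultimately show ?thesis
    using span_base[of u "{v}"] by (auto simp: independent_insert)
qed

lemma orthogonal_to_frame_zero:
  assumes x: "x \<in> U" and dim: "DIM('e) = 2"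
    and on: "g x T T = 1" "g x N N = 1" "g x T N = 0"
    and w: "g x w T = 0" "g x w N = 0"
  shows "w = 0"
proof -
  note b = smooth_bilinear_on_bilinear[OF smooth_metric x]
  have TN: "T \<noteq> N \<and> independent {T, N}"
    by (rule gram_independent[OF x]) (simp add: on)
  then have "(UNIV :: 'e set) \<subseteq> span {T, N}"
    by (intro card_ge_dim_independent) (auto simp: dim)
  then have "w \<in> span {T, N}" by auto
  then obtain p q where "w - p *\<^sub>R T = q *\<^sub>R N"
    by (auto simp: span_insert span_singleton)
  then have w_eq: "w = p *\<^sub>R T + q *\<^sub>R N" by (simp add: algebra_simps)
  have "g x N T = 0" using on sym_metric[OF x] by simp
  with w have "p = 0" "q = 0"
    unfolding w_eq by (simp_all add: bilinear_ladd[OF b] bilinear_lmul[OF b] on)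
  then show ?thesis by (simp add: w_eq)
qed

text \<open>Sectional curvature gives only the values g(R(u,v)v, u). In dimension two the missing
  tangential component of R(N,T)T can be found from them by polarization, and then the vector is
  known from its two components.\<close>

lemma curv_orthonormal:
  assumes x: "x \<in> U" and dim: "DIM('e) = 2"
    and K: "\<And>u v. u \<noteq> v \<and> independent {u, v} \<Longrightarrow>
      g x (curv G x u v v) u / (g x u u * g x v v - (g x u v)\<^sup>2) = C"
    and on: "g x T T = 1" "g x N N = 1" "g x T N = 0"
  shows "curv G x N T T = C *\<^sub>R N" "g x (curv G x N T N) T = - C"
proof -
  note b = smooth_bilinear_on_bilinear[OF smooth_metric x]
  note bs = bilinear_ladd[OF b] bilinear_radd[OF b] bilinear_lmul[OF b] bilinear_rmul[OF b]
    bilinear_lneg[OF b] bilinear_lsub[OF b]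
  note lc = linear_add[OF linear_curv(1)[OF x]] linear_add[OF linear_curv(2)[OF x]]
  have sec: "g x (curv G x u v v) u = C" if "g x u u * g x v v - (g x u v)\<^sup>2 = 1" for u v
    using K[OF gram_independent[OF x, of u v]] that by simp
  have NT: "g x N T = 0" using on sym_metric[OF x] by simp
  have nt: "g x (curv G x N T T) N = C" by (rule sec) (simp add: on NT)
  have "g x (curv G x T N N) T = C" by (rule sec) (simp add: on NT)
  then show tn: "g x (curv G x N T N) T = - C"
    by (simp add: curv_antisym[of x T N] bs)
  \<comment> \<open>The pair T, N + T also has Gram determinant 2 - 1 = 1. Since R(T,T) = 0,
    expanding yields the known component of R(N,T)N plus the unknown one of R(N,T)T, which must
    vanish.\<close>
  have "g x (curv G x T (N + T) (N + T)) T = C"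
    by (rule sec) (simp add: on NT bs)
  moreover have "curv G x T T w = 0" for w
    using curv_antisym[of x T T w] by (simp add: eq_neg_iff_add_eq_0 flip: scaleR_2)
  ultimately have tt: "g x (curv G x N T T) T = 0"
    using tn by (simp add: curv_antisym[of x T "N + T"] lc bs)
  have "curv G x N T T - C *\<^sub>R N = 0"
    by (rule orthogonal_to_frame_zero[OF x dim on]) (simp_all add: bs tt nt NT on)
  then show "curv G x N T T = C *\<^sub>R N" by simp
qed

text \<open>
  First variation of the 3-energy density along a curve of constant geodesic curvature \<open>k\<close>, for
  the variation field \<open>\<alpha> T + \<beta> N\<close>.
\<close>

lemma density_variation:
  fixes y :: "real \<times> real \<Rightarrow> 'e"
  defines "S \<equiv> \<lambda>q. frechet_derivative y (at q) (0, 1)"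
  assumes dim: "DIM('e) = 2"
    and K: "\<And>x u v. x \<in> U \<Longrightarrow> u \<noteq> v \<and> independent {u, v} \<Longrightarrow>
      g x (curv G x u v v) u / (g x u u * g x v v - (g x u v)\<^sup>2) = C"
    and P: "open P" and y: "smooth_on P y" "y ` P \<subseteq> U"
    and J: "open J" "\<And>s. s \<in> J \<Longrightarrow> (0, s) \<in> P"
    and T: "\<And>s. s \<in> J \<Longrightarrow> S (0, s) = T s" and N: "smooth_on J N"
    and on: "\<And>s. s \<in> J \<Longrightarrow> g (y (0, s)) (T s) (T s) = 1"
      "\<And>s. s \<in> J \<Longrightarrow> g (y (0, s)) (N s) (N s) = 1"
      "\<And>s. s \<in> J \<Longrightarrow> g (y (0, s)) (T s) (N s) = 0"
    and frenet: "\<And>s. s \<in> J \<Longrightarrow> cov G (\<lambda>s. y (0, s)) 1 T s = k *\<^sub>R N s"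
      "\<And>s. s \<in> J \<Longrightarrow> cov G (\<lambda>s. y (0, s)) 1 N s = - k *\<^sub>R T s"
    and V: "\<And>s. s \<in> J \<Longrightarrow> frechet_derivative y (at (0, s)) (1, 0) = \<alpha> s *\<^sub>R T s + \<beta> s *\<^sub>R N s"
    and \<alpha>: "\<And>s. s \<in> J \<Longrightarrow> (\<alpha> has_real_derivative \<alpha>1 s) (at s)"
      "\<And>s. s \<in> J \<Longrightarrow> (\<alpha>1 has_real_derivative \<alpha>2 s) (at s)"
      "\<And>s. s \<in> J \<Longrightarrow> (\<alpha>2 has_real_derivative \<alpha>3 s) (at s)"
    and \<beta>: "\<And>s. s \<in> J \<Longrightarrow> (\<beta> has_real_derivative \<beta>1 s) (at s)"
      "\<And>s. s \<in> J \<Longrightarrow> (\<beta>1 has_real_derivative \<beta>2 s) (at s)"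
      "\<And>s. s \<in> J \<Longrightarrow> (\<beta>2 has_real_derivative \<beta>3 s) (at s)"
    and s: "s \<in> J"
  shows "g (y (0, s)) (cov G y (1, 0) (cov G y (0, 1) (cov G y (0, 1) S)) (0, s))
      (cov G y (0, 1) (cov G y (0, 1) S) (0, s)) =
    - k\<^sup>2 * (\<alpha>3 s - 3 * k * \<beta>2 s - 3 * k\<^sup>2 * \<alpha>1 s + (k ^ 3 - 2 * k * C) * \<beta> s)"
proof -
  let ?x = "\<lambda>s. y (0, s)"
  let ?V = "\<lambda>q. frechet_derivative y (at q) (1, 0)"
  have xU: "?x s \<in> U" if "s \<in> J" for s using J(2)[OF that] y(2) by auto
  have S: "smooth_on P S" and V': "smooth_on P ?V"
    unfolding S_def by (intro smooth_on_frechet_derivative y)+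
  note cv = smooth_on_cov[OF P y]
  have slice_smooth: "smooth_on J (\<lambda>s. Z (0, s))" if "smooth_on P Z" for Z :: "real \<times> real \<Rightarrow> 'e"
    by (rule smooth_on_compose[OF J(1) P _ _ that])
      (use J in \<open>auto intro!: smooth_on_Pair smooth_on_const smooth_on_ident\<close>)
  \<comment> \<open>A derivative along the curve needs the field at time 0 only. Time derivatives do
    not restrict in this way and must be commuted inward first.\<close>
  have slice: "cov G y (0, 1) Z (0, s) = cov G ?x 1 W s"
    if Z: "smooth_on P Z" and W: "\<And>s. s \<in> J \<Longrightarrow> Z (0, s) = W s" and s: "s \<in> J" for Z W s
  proof -
    have "cov G y (0, 1) Z (0, s) = cov G ?x 1 (\<lambda>s. Z (0, s)) s"
      by (rule cov_slice[symmetric]; rule smooth_on_differentiable[OF _ J(2)[OF s]]; fact)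
    also have "\<dots> = cov G ?x 1 W s"
      by (rule cov_cong[OF J(1) W s, symmetric])
        (auto intro: smooth_on_differentiable[OF slice_smooth[OF Z] s])
    finally show ?thesis .
  qed
  have Ts: "smooth_on J T"
    by (rule smooth_on_cong[OF J(1) T slice_smooth[OF S]])
  have frame: "cov G ?x 1 (\<lambda>s. a s *\<^sub>R T s + b s *\<^sub>R N s) s =
      (a' - k * b s) *\<^sub>R T s + (b' + k * a s) *\<^sub>R N s"
    if "(a has_real_derivative a') (at s)" "(b has_real_derivative b') (at s)" "s \<in> J" for a b a' b' s
    using that by (intro cov_frame xU frenet) (auto intro: smooth_on_differentiable[OF Ts] smooth_on_differentiable[OF N])
  have S1: "cov G y (0, 1) S (0, s) = k *\<^sub>R N s" if "s \<in> J" for s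
    using slice[OF S T that] frenet(1)[OF that] by simp
  \<comment> \<open>The null multiple of \<open>T\<close> in \<open>W\<close> only gives k N the
    shape required by \<open>frame\<close>.\<close>
  have S2: "cov G y (0, 1) (cov G y (0, 1) S) (0, s) = - (k\<^sup>2) *\<^sub>R T s" if "s \<in> J" for s
    using slice[OF cv[OF S] _ that, where W = "\<lambda>s. 0 *\<^sub>R T s + k *\<^sub>R N s"] S1
      frame[OF DERIV_const DERIV_const that, of 0 k] by (simp add: power2_eq_square)
  have V1: "cov G y (0, 1) ?V (0, s) = (\<alpha>1 s - k * \<beta> s) *\<^sub>R T s + (\<beta>1 s + k * \<alpha> s) *\<^sub>R N s"
    if "s \<in> J" for s
    using slice[OF V' V that] frame[OF \<alpha>(1) \<beta>(1) that] that by simp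
  have V2: "cov G y (0, 1) (cov G y (0, 1) ?V) (0, s) =
      (\<alpha>2 s - 2 * k * \<beta>1 s - k\<^sup>2 * \<alpha> s) *\<^sub>R T s + (\<beta>2 s + 2 * k * \<alpha>1 s - k\<^sup>2 * \<beta> s) *\<^sub>R N s"
    if "s \<in> J" for s
  proof -
    have "((\<lambda>s. \<alpha>1 s - k * \<beta> s) has_real_derivative \<alpha>2 s - k * \<beta>1 s) (at s)"
      "((\<lambda>s. \<beta>1 s + k * \<alpha> s) has_real_derivative \<beta>2 s + k * \<alpha>1 s) (at s)"
      using that by (auto intro!: derivative_eq_intros \<alpha> \<beta>)
    from frame[OF this that] slice[OF cv[OF V'] V1 that] show ?thesis
      by (simp add: algebra_simps power2_eq_square)
  qed
  have K': "curv G (?x s) (N s) (T s) (T s) = C *\<^sub>R N s" "g (?x s) (curv G (?x s) (N s) (T s) (N s)) (T s) = - C"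
    if "s \<in> J" for s
    by (rule curv_orthonormal[OF xU[OF that] dim K[OF xU[OF that]] on[OF that]]; assumption)+
  have curvV: "curv G (?x s) (\<alpha> s *\<^sub>R T s + \<beta> s *\<^sub>R N s) (T s) w = \<beta> s *\<^sub>R curv G (?x s) (N s) (T s) w"
    if "s \<in> J" for s w
  proof -
    have "curv G (?x s) (T s) (T s) w = 0"
      using curv_antisym[of "?x s" "T s" "T s" w] by (simp add: eq_neg_iff_add_eq_0 flip: scaleR_2)
    then show ?thesis
      by (simp add: linear_add[OF linear_curv(1)[OF xU[OF that]]] linear_cmul[OF linear_curv(1)[OF xU[OF that]]])
  qed
  \<comment> \<open>The first exchange: it adds R(V,T)T, which for V = \<alpha> T + \<beta> N equals
    C \<beta> N.\<close>
  have W: "cov G y (1, 0) (cov G y (0, 1) S) (0, s) =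
      (\<alpha>2 s - 2 * k * \<beta>1 s - k\<^sup>2 * \<alpha> s) *\<^sub>R T s
      + (\<beta>2 s + 2 * k * \<alpha>1 s - k\<^sup>2 * \<beta> s + C * \<beta> s) *\<^sub>R N s"
    if "s \<in> J" for s
    using cov_variation_tension[OF P J(2)[OF that] y, of "(1, 0)" "(0, 1)"] V2[OF that] T[OF that]
    unfolding V[OF that] S_def by (simp add: curvV[OF that] K'(1)[OF that] algebra_simps)
  have W1: "cov G y (0, 1) (cov G y (1, 0) (cov G y (0, 1) S)) (0, s) =
      (\<alpha>3 s - 2 * k * \<beta>2 s - k\<^sup>2 * \<alpha>1 s - k * (\<beta>2 s + 2 * k * \<alpha>1 s - k\<^sup>2 * \<beta> s + C * \<beta> s)) *\<^sub>R T s
      + (\<beta>3 s + 2 * k * \<alpha>2 s - k\<^sup>2 * \<beta>1 s + C * \<beta>1 s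
        + k * (\<alpha>2 s - 2 * k * \<beta>1 s - k\<^sup>2 * \<alpha> s)) *\<^sub>R N s"
  proof -
    have "((\<lambda>s. \<alpha>2 s - 2 * k * \<beta>1 s - k\<^sup>2 * \<alpha> s) has_real_derivative
        \<alpha>3 s - 2 * k * \<beta>2 s - k\<^sup>2 * \<alpha>1 s) (at s)"
      "((\<lambda>s. \<beta>2 s + 2 * k * \<alpha>1 s - k\<^sup>2 * \<beta> s + C * \<beta> s) has_real_derivative
        \<beta>3 s + 2 * k * \<alpha>2 s - k\<^sup>2 * \<beta>1 s + C * \<beta>1 s) (at s)"
      using s by (auto intro!: derivative_eq_intros \<alpha> \<beta>)
    from frame[OF this s] slice[OF cv[OF cv[OF S]] W s] show ?thesis by simp
  qed
  note b = smooth_bilinear_on_bilinear[OF smooth_metric xU[OF s]]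
  have NT: "g (?x s) (N s) (T s) = 0" using sym_metric[OF xU[OF s]] on(3)[OF s] by simp
  \<comment> \<open>The second exchange: the field being differentiated is k N, so the additional
    term is k \<beta> R(N,T)N, with tangential component - k C \<beta>.\<close>
  have BB: "cov G y (1, 0) (cov G y (0, 1) (cov G y (0, 1) S)) (0, s) =
      cov G y (0, 1) (cov G y (1, 0) (cov G y (0, 1) S)) (0, s)
      + (\<beta> s * k) *\<^sub>R curv G (?x s) (N s) (T s) (N s)"
    using cov_commute[OF P J(2)[OF s] y cv[OF S], of "(1, 0)" "(0, 1)"] T[OF s] S1[OF s]
    unfolding V[OF s] S_def
    by (simp add: curvV[OF s] linear_cmul[OF linear_curv(2)[OF xU[OF s]]])
  show ?thesis
    unfolding BB S2[OF s] W1
    by (simp add: bilinear_ladd[OF b] bilinear_lmul[OF b] bilinear_rmul[OF b] bilinear_rneg[OF b] on[OF s]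
        NT K'(2)[OF s]) (simp add: algebra_simps power2_eq_square power3_eq_cube)
qed

end

text \<open>The inhomogeneous transformation law of Christoffel symbols. Both sides have the same
  product with every image vector \<open>F z\<close>, by the Koszul formulas in the two charts, and
  the metric is positive definite.\<close>

lemma connection_transform:
  fixes \<phi> :: "'e::euclidean_space \<Rightarrow> 'e"
  assumes "metric_chart U G g" and "metric_chart U' G' g'"
    and V: "open V" "V \<subseteq> U" and \<phi>: "smooth_on V \<phi>" "\<phi> ` V \<subseteq> U'"
    and iso: "\<And>x u v. x \<in> V \<Longrightarrow>
      g x u v = g' (\<phi> x) (frechet_derivative \<phi> (at x) u) (frechet_derivative \<phi> (at x) v)"
    and x: "x \<in> V"
  shows "frechet_derivative \<phi> (at x) (G x u v) =
    G' (\<phi> x) (frechet_derivative \<phi> (at x) u) (frechet_derivative \<phi> (at x) v)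
    + frechet_derivative (\<lambda>y. frechet_derivative \<phi> (at y) v) (at x) u"
proof -
  interpret A: metric_chart U G g by fact
  interpret B: metric_chart U' G' g' by fact
  have xU: "x \<in> U" "\<phi> x \<in> U'" using V \<phi> x by auto
  note bA = smooth_bilinear_on_bilinear[OF A.smooth_metric xU(1)]
  note bB = smooth_bilinear_on_bilinear[OF B.smooth_metric xU(2)]
  define F where "F = frechet_derivative \<phi> (at x)"
  define H where "H u v = frechet_derivative (\<lambda>y. frechet_derivative \<phi> (at y) v) (at x) u" for u v
  have linF: "linear F"
    unfolding F_def by (intro linear_frechet_derivative smooth_on_differentiable[OF \<phi>(1) x])
  have H_sym: "H u v = H v u" for u v
    unfolding H_def by (rule frechet_derivative_commute[OF V(1) \<phi>(1) x])
  have d: "dbilin g x w u v =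
      dbilin g' (\<phi> x) (F w) (F u) (F v) + g' (\<phi> x) (H w u) (F v) + g' (\<phi> x) (F u) (H w v)" for u v w
  proof -
    have "((\<lambda>z. g' (\<phi> z) (frechet_derivative \<phi> (at z) u) (frechet_derivative \<phi> (at z) v)) has_derivative
        (\<lambda>h. dbilin g' (\<phi> x) (F h) (F u) (F v) + g' (\<phi> x) (H h u) (F v) + g' (\<phi> x) (F u) (H h v))) (at x)"
      unfolding F_def H_def
      by (intro smooth_bilinear_on_compose_has_derivative[OF B.smooth_metric] xU
          smooth_on_has_derivative[OF _ x] smooth_on_frechet_derivative \<phi>(1))
    then have "((\<lambda>z. g z u v) has_derivative
        (\<lambda>h. dbilin g' (\<phi> x) (F h) (F u) (F v) + g' (\<phi> x) (H h u) (F v) + g' (\<phi> x) (F u) (H h v))) (at x)"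
      by (rule has_derivative_transform_within_open[OF _ V(1) x]) (rule iso[symmetric])
    then show ?thesis
      unfolding dbilin_def[of g] by (rule fun_cong[OF frechet_derivative_eqI])
  qed
  have gF: "g x u v = g' (\<phi> x) (F u) (F v)" for u v
    using iso[OF x] by (simp add: F_def)
  \<comment> \<open>An isometric linear map is injective, hence bijective in finite dimension; no
    inverse of \<phi> is required.\<close>
  have "inj F"
    unfolding linear_injective_0[OF linF]
  proof (intro allI impI)
    fix u assume "F u = 0"
    then have "g x u u = 0" by (simp add: gF bilinear_lzero[OF bB])
    then show "u = 0" using A.pos_def[OF xU(1), of u] by force
  qed
  then have surjF: "surj F" using linF by (simp add: linear_inj_imp_surj)
  define w where "w = F (G x u v) - (G' (\<phi> x) (F u) (F v) + H u v)"
  have "g' (\<phi> x) w (F z) = 0" for z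
  proof -
    \<comment> \<open>Of the six Hessian terms, four cancel in pairs by symmetry and the other two
      combine to twice the product of \<open>H u v\<close> with \<open>F z\<close>.\<close>
    have "2 * g' (\<phi> x) (F (G x u v)) (F z) = 2 * g' (\<phi> x) (G' (\<phi> x) (F u) (F v) + H u v) (F z)"
      using A.koszul[OF xU(1), of u v z] B.koszul[OF xU(2), of "F u" "F v" "F z"]
        B.sym_metric[OF xU(2), of "F v" "H z u"]
      unfolding gF d bilinear_ladd[OF bB] H_sym[of v u] H_sym[of u z] H_sym[of v z]
      by (simp add: algebra_simps)
    then show ?thesis by (simp add: w_def bilinear_lsub[OF bB])
  qed
  moreover obtain z where "w = F z" using surjF by (rule surjE)
  ultimately have "g' (\<phi> x) w w = 0" by simp
  then have "w = 0" using B.pos_def[OF xU(2), of w] by force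
  then show ?thesis by (simp add: w_def F_def H_def)
qed

text \<open>The Hessian of \<phi> appears twice with opposite effect: in the transformation of the
  Christoffel form and in the derivative of the pushed-forward field. What remains is the law for
  vectors, and it can be iterated because the pushed-forward field is again differentiable.\<close>

lemma cov_transform:
  fixes y :: "'d::euclidean_space \<Rightarrow> 'e::euclidean_space" and \<phi> :: "'e \<Rightarrow> 'e"
  assumes A: "metric_chart U G g" and B: "metric_chart U' G' g'"
    and V: "open V" "V \<subseteq> U" and \<phi>: "smooth_on V \<phi>" "\<phi> ` V \<subseteq> U'"
    and iso: "\<And>x u v. x \<in> V \<Longrightarrow>
      g x u v = g' (\<phi> x) (frechet_derivative \<phi> (at x) u) (frechet_derivative \<phi> (at x) v)"
    and y: "y differentiable (at p)" "y p \<in> V" and Z: "Z differentiable (at p)"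
  shows "cov G' (\<lambda>q. \<phi> (y q)) e (\<lambda>q. frechet_derivative \<phi> (at (y q)) (Z q)) p =
    frechet_derivative \<phi> (at (y p)) (cov G y e Z p)"
    "(\<lambda>q. frechet_derivative \<phi> (at (y q)) (Z q)) differentiable (at p)"
proof -
  define F where "F = frechet_derivative \<phi> (at (y p))"
  define H where "H u v = frechet_derivative (\<lambda>y. frechet_derivative \<phi> (at y) v) (at (y p)) u" for u v
  have dF: "((\<lambda>x. frechet_derivative \<phi> (at x) v) has_derivative (\<lambda>h. H h v)) (at (y p))" for v
    unfolding H_def by (intro smooth_on_has_derivative[OF _ y(2)] smooth_on_frechet_derivative \<phi>(1))
  have F_lin: "linear (frechet_derivative \<phi> (at x))" if "x \<in> V" for x
    by (intro linear_frechet_derivative smooth_on_differentiable[OF \<phi>(1) that])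
  have H_sym: "H u v = H v u" for u v
    unfolding H_def by (rule frechet_derivative_commute[OF V(1) \<phi>(1) y(2)])
  \<comment> \<open>Linearity in the direction of differentiation is immediate; symmetry of the
    Hessian transfers it to the other slot.\<close>
  have H_lin: "linear (H u)" for u
  proof -
    have "H u = (\<lambda>h. H h u)" by (rule ext) (rule H_sym)
    then show ?thesis using has_derivative_linear[OF dF, of u] by simp
  qed
  have expand: "L v = (\<Sum>i\<in>Basis. (v \<bullet> i) *\<^sub>R L i)" if "linear L" for L :: "'e \<Rightarrow> 'e" and v
    using arg_cong[OF euclidean_representation[of v], of L]
    by (simp add: linear_sum[OF that] linear_cmul[OF that])
  have ev: "\<forall>\<^sub>F q in at p. y q \<in> V"
    using has_derivative_continuous[OF has_derivative_frechet[OF y(1)]] V(1) y(2)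
    by (metis continuous_within topological_tendstoD)
  have "((\<lambda>q. \<Sum>i\<in>Basis. (Z q \<bullet> i) *\<^sub>R frechet_derivative \<phi> (at (y q)) i) has_derivative
     (\<lambda>h. \<Sum>i\<in>Basis. (Z p \<bullet> i) *\<^sub>R H (frechet_derivative y (at p) h) i
        + (frechet_derivative Z (at p) h \<bullet> i) *\<^sub>R F i)) (at p)"
    unfolding F_def
    by (intro has_derivative_sum has_derivative_scaleR has_derivative_inner_left has_derivative_frechet
        y(1) Z has_derivative_compose[OF has_derivative_frechet[OF y(1)] dF])
  also have "(\<lambda>h. \<Sum>i\<in>Basis. (Z p \<bullet> i) *\<^sub>R H (frechet_derivative y (at p) h) i
        + (frechet_derivative Z (at p) h \<bullet> i) *\<^sub>R F i) =
     (\<lambda>h. H (frechet_derivative y (at p) h) (Z p) + F (frechet_derivative Z (at p) h))"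
    by (rule ext) (simp add: sum.distrib expand[OF H_lin, of _ "Z p"]
        expand[OF F_lin[OF y(2)], folded F_def, of "frechet_derivative Z (at p) _"])
  finally have D: "((\<lambda>q. frechet_derivative \<phi> (at (y q)) (Z q)) has_derivative
      (\<lambda>h. H (frechet_derivative y (at p) h) (Z p) + F (frechet_derivative Z (at p) h))) (at p)"
    by (rule has_derivative_transform_eventually)
      (use ev y(2) in \<open>auto elim!: eventually_mono simp: expand[OF F_lin, symmetric]\<close>)
  then show "(\<lambda>q. frechet_derivative \<phi> (at (y q)) (Z q)) differentiable (at p)"
    by (auto simp: differentiable_def)
  have "frechet_derivative (\<lambda>q. \<phi> (y q)) (at p) = (\<lambda>h. F (frechet_derivative y (at p) h))"
    unfolding F_def
    by (rule frechet_derivative_eqI[OF has_derivative_compose[OF has_derivative_frechet[OF y(1)]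
          smooth_on_has_derivative[OF \<phi>(1) y(2)]]])
  then show "cov G' (\<lambda>q. \<phi> (y q)) e (\<lambda>q. frechet_derivative \<phi> (at (y q)) (Z q)) p =
    frechet_derivative \<phi> (at (y p)) (cov G y e Z p)"
    using connection_transform[OF A B V \<phi> iso y(2), of "frechet_derivative y (at p) e" "Z p"]
    by (simp add: cov_def frechet_derivative_eqI[OF D] linear_add[OF F_lin[OF y(2)], folded F_def]
        flip: F_def H_def)
qed

section \<open>The Levi-Civita connection of a surface\<close>

lemma sum_Basis_2: "(z::real^2) = z $ 1 *\<^sub>R axis 1 1 + z $ 2 *\<^sub>R axis 2 1"
  by (simp add: vec_eq_iff forall_2 axis_def)

text \<open>Cramer's rule for the two linear equations that the Koszul formula imposes.\<close>

definition levi_civita ::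
  "(real^2 \<Rightarrow> real^2 \<Rightarrow> real^2 \<Rightarrow> real) \<Rightarrow> real^2 \<Rightarrow> real^2 \<Rightarrow> real^2 \<Rightarrow> real^2" where
  "levi_civita g x u v = (let e = axis 1 1; f = axis 2 1;
      L = (\<lambda>z. dbilin g x u v z + dbilin g x v u z - dbilin g x z u v)
    in inverse (2 * (g x e e * g x f f - g x e f * g x e f)) *\<^sub>R
      ((g x f f * L e - g x e f * L f) *\<^sub>R e + (g x e e * L f - g x e f * L e) *\<^sub>R f))"

context
  fixes M :: "('a, real^2) manifold"
  assumes M: "riemannian_manifold M"
begin

text \<open>A definite description yields neither existence nor smoothness of
  \<open>christoffel\<close>. The explicit solution by Cramer's rule supplies both, while symmetry
  and bilinearity follow from uniqueness alone.\<close>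

lemma metric_chart_christoffel:
  assumes c: "c \<in> atlas M"
  shows "metric_chart (cmap c ` cdom c) (christoffel M c) (metric M c)"
proof -
  define U where "U = cmap c ` cdom c"
  define g where "g = metric M c"
  have U: "open U" and sg: "\<And>u v. smooth_on U (\<lambda>x. g x u v)"
    and b: "\<And>x. x \<in> U \<Longrightarrow> bilinear (g x)" and sym: "\<And>x u v. x \<in> U \<Longrightarrow> g x u v = g x v u"
    and pos: "\<And>x u. x \<in> U \<Longrightarrow> u \<noteq> 0 \<Longrightarrow> g x u u > 0"
    using M c unfolding riemannian_manifold_def smooth_manifold_def U_def g_def by blast+
  have sb: "smooth_bilinear_on U g"
    using U sg b by (simp add: smooth_bilinear_on_def)
  define L where "L x u v z = dbilin g x u v z + dbilin g x v u z - dbilin g x z u v" for x u v z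
  define e f :: "real^2" where "e = axis 1 1" and "f = axis 2 1"
  define det where "det x = g x e e * g x f f - g x e f * g x e f" for x
  have lc: "levi_civita g x u v = inverse (2 * det x) *\<^sub>R
      ((g x f f * L x u v e - g x e f * L x u v f) *\<^sub>R e + (g x e e * L x u v f - g x e f * L x u v e) *\<^sub>R f)"
    for x u v
    by (simp add: levi_civita_def Let_def L_def e_def f_def det_def)
  have z_eq: "z = z $ 1 *\<^sub>R e + z $ 2 *\<^sub>R f" for z
    unfolding e_def f_def by (rule sum_Basis_2)
  have unique: "w = w'" if x: "x \<in> U" and "\<And>z. g x w z = g x w' z" for x w w'
  proof -
    have "g x (w - w') (w - w') = 0" using that(2) by (simp add: bilinear_lsub[OF b[OF x]])
    then show ?thesis using pos[OF x, of "w - w'"] by force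
  qed
  have det: "det x > 0" if x: "x \<in> U" for x
  proof -
    have f: "g x f f > 0" by (rule pos[OF x]) (simp add: f_def axis_eq_0_iff)
    have "(g x f f *\<^sub>R e - g x e f *\<^sub>R f) $ 1 = g x f f" by (simp add: e_def f_def axis_def)
    \<comment> \<open>This multiple of the component of \<open>e\<close> orthogonal to
      \<open>f\<close> has squared length g(f,f) times the Gram determinant, which is therefore
      positive.\<close>
    with f have "g x f f *\<^sub>R e - g x e f *\<^sub>R f \<noteq> 0" by force
    from pos[OF x this] have "g x f f * det x > 0"
      by (simp add: bilinear_lsub[OF b[OF x]] bilinear_rsub[OF b[OF x]] bilinear_lmul[OF b[OF x]]
          bilinear_rmul[OF b[OF x]] sym[OF x, of f e] det_def algebra_simps)
    with f show ?thesis by (simp add: zero_less_mult_iff)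
  qed
  have linL: "linear (L x u v)" if x: "x \<in> U" for x u v
  proof -
    note d = bilinear_dbilin[OF sb x]
    have l: "linear (\<lambda>h. dbilin g x h a b)" for a b
      using smooth_bilinear_on_has_derivative[OF sb x] has_derivative_linear by blast
    show ?thesis
      by (rule linearI) (simp_all add: L_def linear_add[OF l] linear_cmul[OF l]
          bilinear_radd[OF d] bilinear_rmul[OF d] algebra_simps)
  qed
  have kos: "2 * g x (levi_civita g x u v) z = L x u v z" if x: "x \<in> U" for x u v z
  proof -
    note bl = bilinear_ladd[OF b[OF x]] bilinear_lmul[OF b[OF x]] bilinear_radd[OF b[OF x]]
      bilinear_rmul[OF b[OF x]]
    have glc: "2 * g x (levi_civita g x u v) w = 2 * (inverse (2 * det x) *
        ((g x f f * L x u v e - g x e f * L x u v f) * g x e w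
          + (g x e e * L x u v f - g x e f * L x u v e) * g x f w))" for w
      by (simp only: lc bl real_scaleR_def)
    have "(g x f f * L x u v e - g x e f * L x u v f) * g x e e
          + (g x e e * L x u v f - g x e f * L x u v e) * g x f e = det x * L x u v e"
      "(g x f f * L x u v e - g x e f * L x u v f) * g x e f
          + (g x e e * L x u v f - g x e f * L x u v e) * g x f f = det x * L x u v f"
      by (simp_all add: sym[OF x, of f e] det_def algebra_simps)
    then have ef: "2 * g x (levi_civita g x u v) e = L x u v e" "2 * g x (levi_civita g x u v) f = L x u v f"
      unfolding glc using det[OF x] by simp_all
    have "2 * g x (levi_civita g x u v) (z $ 1 *\<^sub>R e + z $ 2 *\<^sub>R f) = L x u v (z $ 1 *\<^sub>R e + z $ 2 *\<^sub>R f)"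
      using ef by (simp add: bl linear_add[OF linL[OF x]] linear_cmul[OF linL[OF x]] algebra_simps)
    then show ?thesis by (simp flip: z_eq)
  qed
  have chr: "christoffel M c x u v = levi_civita g x u v" if x: "x \<in> U" for x u v
    unfolding christoffel_def
  proof (rule the_equality)
    show "\<forall>z. 2 * metric M c x (levi_civita g x u v) z =
       frechet_derivative (\<lambda>y. metric M c y v z) (at x) u
     + frechet_derivative (\<lambda>y. metric M c y u z) (at x) v
     - frechet_derivative (\<lambda>y. metric M c y u v) (at x) z"
      using kos[OF x] by (simp add: L_def dbilin_def g_def)
    fix w assume w: "\<forall>z. 2 * metric M c x w z =
       frechet_derivative (\<lambda>y. metric M c y v z) (at x) u
     + frechet_derivative (\<lambda>y. metric M c y u z) (at x) v
     - frechet_derivative (\<lambda>y. metric M c y u v) (at x) z"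
    have "g x w z = g x (levi_civita g x u v) z" for z
      using w[rule_format, of z] kos[OF x, of u v z] by (simp add: L_def dbilin_def g_def)
    then show "w = levi_civita g x u v" by (rule unique[OF x])
  qed
  have kos': "2 * g x (christoffel M c x u v) z = L x u v z" if "x \<in> U" for x u v z
    using kos[OF that] chr[OF that] by simp
  have sL: "smooth_on U (\<lambda>x. L x u v z)" for u v z
    unfolding L_def dbilin_def
    by (intro smooth_on_diff smooth_on_add smooth_on_frechet_derivative U sg)
  have "smooth_on U (\<lambda>x. levi_civita g x u v)" for u v
    unfolding lc det_def
    by (intro smooth_on_scaleR smooth_on_add smooth_on_inverse smooth_on_mult smooth_on_diff smooth_on_const U sL sg)
      (use det in \<open>force simp: det_def\<close>)
  then have smooth: "smooth_on U (\<lambda>x. christoffel M c x u v)" for u v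
    by (rule smooth_on_cong[OF U, rotated]) (simp add: chr)
  have bil: "bilinear (christoffel M c x)" if x: "x \<in> U" for x
  proof -
    note d = bilinear_dbilin[OF sb x]
    have l: "linear (\<lambda>h. dbilin g x h a b)" for a b
      using smooth_bilinear_on_has_derivative[OF sb x] has_derivative_linear by blast
    \<comment> \<open>Since the metric is nondegenerate, an identity for \<open>christoffel\<close>
      can be checked on the right-hand side \<open>L\<close> of the Koszul formula.\<close>
    have eqI: "christoffel M c x u v = w" if "\<And>z. L x u v z = 2 * g x w z" for w u v
    proof (rule unique[OF x])
      show "g x (christoffel M c x u v) z = g x w z" for z
        using that[of z] kos'[OF x, of u v z] by simp
    qed
    have L: "L x u (v + v') z = L x u v z + L x u v' z" "L x u (r *\<^sub>R v) z = r * L x u v z"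
      "L x (u + u') v z = L x u v z + L x u' v z" "L x (r *\<^sub>R u) v z = r * L x u v z"
      for u u' v v' z r
      by (simp_all add: L_def linear_add[OF l] linear_cmul[OF l] bilinear_ladd[OF d] bilinear_lmul[OF d]
            bilinear_radd[OF d] bilinear_rmul[OF d] algebra_simps)
    have "christoffel M c x u (v + v') = christoffel M c x u v + christoffel M c x u v'"
      "christoffel M c x u (r *\<^sub>R v) = r *\<^sub>R christoffel M c x u v"
      "christoffel M c x (u + u') v = christoffel M c x u v + christoffel M c x u' v"
      "christoffel M c x (r *\<^sub>R u) v = r *\<^sub>R christoffel M c x u v" for u u' v v' r
      by (rule eqI; unfold L; simp add: bilinear_ladd[OF b[OF x]] bilinear_lmul[OF b[OF x]] flip: kos'[OF x])+
    then show ?thesis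
      unfolding bilinear_def by (auto intro: linearI)
  qed
  have Lsym: "L x u v z = L x v u z" if x: "x \<in> U" for x u v z
  proof -
    have "dbilin g x z u v = dbilin g x z v u"
      unfolding dbilin_def
      by (rule fun_cong[OF frechet_derivative_cong[OF U _ x smooth_on_differentiable[OF sg x]]]) (rule sym)
    then show ?thesis by (simp add: L_def)
  qed
  show ?thesis
    unfolding U_def[symmetric] g_def[symmetric]
  proof
    show "smooth_bilinear_on U (christoffel M c)"
      using U bil smooth by (simp add: smooth_bilinear_on_def)
    show "christoffel M c x u v = christoffel M c x v u" if "x \<in> U" for x u v
    proof (rule unique[OF that])
      show "g x (christoffel M c x u v) z = g x (christoffel M c x v u) z" for z
        using kos'[OF that, of u v z] kos'[OF that, of v u z] Lsym[OF that, of u v z] by simp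
    qed
    show "2 * g x (christoffel M c x u v) z = dbilin g x u v z + dbilin g x v u z - dbilin g x z u v"
      if "x \<in> U" for x u v z using kos'[OF that] by (simp add: L_def)
  qed (use sb sym pos in auto)
qed

end

section \<open>Change of charts\<close>

context
  fixes M :: "('a, 'e::euclidean_space) manifold"
  assumes M: "smooth_manifold M"
begin

lemma chart_open:
  assumes "c \<in> atlas M"
  shows "openin (top_of M) (cdom c)" "open (cmap c ` cdom c)" "inj_on (cmap c) (cdom c)"
    and "homeomorphic_map (subtopology (top_of M) (cdom c)) (top_of_set (cmap c ` cdom c)) (cmap c)"
proof -
  show o: "openin (top_of M) (cdom c)" and "open (cmap c ` cdom c)"
    and h: "homeomorphic_map (subtopology (top_of M) (cdom c)) (top_of_set (cmap c ` cdom c)) (cmap c)"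
    using M assms by (auto simp: smooth_manifold_def)
  have "topspace (subtopology (top_of M) (cdom c)) = cdom c"
    using openin_subset[OF o] by auto
  then show "inj_on (cmap c) (cdom c)"
    using homeomorphic_imp_injective_map[OF h] by simp
qed

lemma transition_cmap:
  assumes "c \<in> atlas M" "p \<in> cdom c"
  shows "transition c d (cmap c p) = cmap d p"
  using assms by (simp add: transition_def inv_into_f_f[OF chart_open(3)])

lemma open_chart_image:
  assumes c: "c \<in> atlas M" and W: "openin (top_of M) W"
  shows "open (cmap c ` (cdom c \<inter> W))"
proof -
  have "openin (subtopology (top_of M) (cdom c)) (cdom c \<inter> W)"
    using openin_subtopology_Int2[OF W] by simp
  then have "openin (top_of_set (cmap c ` cdom c)) (cmap c ` (cdom c \<inter> W))"
    using homeomorphic_imp_open_map[OF chart_open(4)[OF c]] by (simp add: open_map_def)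
  then show ?thesis
    using chart_open(2)[OF c] by (auto simp: openin_open_eq)
qed

lemma open_overlap:
  "c \<in> atlas M \<Longrightarrow> d \<in> atlas M \<Longrightarrow> open (cmap c ` (cdom c \<inter> cdom d))"
  by (rule open_chart_image[OF _ chart_open(1)])

lemma smooth_on_transition:
  "c \<in> atlas M \<Longrightarrow> d \<in> atlas M \<Longrightarrow> smooth_on (cmap c ` (cdom c \<inter> cdom d)) (transition c d)"
  using M by (simp add: smooth_manifold_def)

lemma mem_overlap:
  assumes "c \<in> atlas M" "p \<in> cdom c"
  shows "cmap c p \<in> cmap c ` (cdom c \<inter> cdom d) \<longleftrightarrow> p \<in> cdom d"
  using chart_open(3)[OF assms(1)] assms(2) by (auto simp: inj_on_def)

end

section \<open>Curves in a Riemannian surface and their derivatives in charts\<close>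

lemma vector_derivative_eq_frechet:
  "f differentiable (at s) \<Longrightarrow> vector_derivative f (at s) = frechet_derivative f (at s) 1"
  by (simp add: frechet_derivative_eq_vector_derivative)

context
  fixes M :: "('a, real^2) manifold"
  assumes M: "riemannian_manifold M"
begin

lemma smooth_M: "smooth_manifold M"
  using M by (simp add: riemannian_manifold_def)

lemma covariant_deriv_eq_cov:
  assumes "(cmap c \<circ> \<sigma>) differentiable (at s)" "X c differentiable (at s)"
  shows "covariant_deriv M \<sigma> X c s = cov (christoffel M c) (cmap c \<circ> \<sigma>) 1 (X c) s"
  by (simp add: covariant_deriv_def cov_def velocity_def vector_derivative_eq_frechet assms)

text \<open>Each field is identified on the whole open set \<open>J\<close>, not just at one point,
  because the next one is obtained by differentiating it.\<close>

lemma tension_eq_cov: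
  assumes c: "c \<in> atlas M" and J: "open J" "\<And>s. s \<in> J \<Longrightarrow> \<sigma> s \<in> cdom c"
    and x: "smooth_on J (cmap c \<circ> \<sigma>)"
  defines "S \<equiv> \<lambda>s. frechet_derivative (cmap c \<circ> \<sigma>) (at s) 1"
  assumes s: "s \<in> J"
  shows "velocity \<sigma> c s = S s"
    "tension M \<sigma> c s = cov (christoffel M c) (cmap c \<circ> \<sigma>) 1 S s"
    "covariant_deriv M \<sigma> (tension M \<sigma>) c s =
      cov (christoffel M c) (cmap c \<circ> \<sigma>) 1 (cov (christoffel M c) (cmap c \<circ> \<sigma>) 1 S) s"
proof -
  interpret metric_chart "cmap c ` cdom c" "christoffel M c" "metric M c"
    by (rule metric_chart_christoffel[OF M c])
  have xU: "(cmap c \<circ> \<sigma>) ` J \<subseteq> cmap c ` cdom c" using J(2) by auto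
  note xd = smooth_on_differentiable[OF x]
  have S: "smooth_on J S" unfolding S_def by (rule smooth_on_frechet_derivative[OF x])
  have v: "velocity \<sigma> c s = S s" if "s \<in> J" for s
    by (simp add: velocity_def S_def vector_derivative_eq_frechet[OF xd[OF that]])
  have vs: "smooth_on J (velocity \<sigma> c)"
    by (rule smooth_on_cong[OF J(1) _ S]) (rule v[symmetric])
  have t: "tension M \<sigma> c s = cov (christoffel M c) (cmap c \<circ> \<sigma>) 1 S s" if "s \<in> J" for s
    unfolding tension_def covariant_deriv_eq_cov[of c \<sigma> _ "velocity \<sigma>", OF xd[OF that] smooth_on_differentiable[OF vs that]]
    by (rule cov_cong[OF J(1) _ that smooth_on_differentiable[OF S that]]) (rule v[symmetric])
  note cS = smooth_on_cov[OF J(1) x xU S]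
  have ts: "smooth_on J (tension M \<sigma> c)"
    by (rule smooth_on_cong[OF J(1) _ cS]) (rule t[symmetric])
  show "covariant_deriv M \<sigma> (tension M \<sigma>) c s =
      cov (christoffel M c) (cmap c \<circ> \<sigma>) 1 (cov (christoffel M c) (cmap c \<circ> \<sigma>) 1 S) s"
    unfolding covariant_deriv_eq_cov[of c \<sigma> _ "tension M \<sigma>", OF xd[OF s] smooth_on_differentiable[OF ts s]]
    by (rule cov_cong[OF J(1) _ s smooth_on_differentiable[OF cS s]]) (rule t[symmetric])
  show "velocity \<sigma> c s = S s"
    "tension M \<sigma> c s = cov (christoffel M c) (cmap c \<circ> \<sigma>) 1 S s"
    by (rule v[OF s] t[OF s])+
qed

lemma metric_transition:
  assumes "c \<in> atlas M" "d \<in> atlas M" "x \<in> cmap c ` (cdom c \<inter> cdom d)"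
  shows "metric M c x u v = metric M d (transition c d x)
    (frechet_derivative (transition c d) (at x) u) (frechet_derivative (transition c d) (at x) v)"
proof -
  obtain p where p: "p \<in> cdom c \<inter> cdom d" "x = cmap c p" using assms(3) by blast
  have "metric M c (cmap c p) u v = metric M d (cmap d p)
      (frechet_derivative (transition c d) (at (cmap c p)) u)
      (frechet_derivative (transition c d) (at (cmap c p)) v)"
    using M assms(1,2) p(1) unfolding riemannian_manifold_def by blast
  then show ?thesis
    using transition_cmap[OF smooth_M assms(1), of p d] p by simp
qed

text \<open>Replaces the chart selected inside \<open>inner_along\<close> by any given chart, for
  fields that transform like vectors at the point in question.\<close>

lemma inner_along_eq:
  assumes c: "c \<in> atlas M" "\<sigma> s \<in> cdom c"
    and X: "\<And>d. d \<in> atlas M \<Longrightarrow> \<sigma> s \<in> cdom d \<Longrightarrow>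
      X d s = frechet_derivative (transition c d) (at (cmap c (\<sigma> s))) (X c s)"
    and Y: "\<And>d. d \<in> atlas M \<Longrightarrow> \<sigma> s \<in> cdom d \<Longrightarrow>
      Y d s = frechet_derivative (transition c d) (at (cmap c (\<sigma> s))) (Y c s)"
  shows "inner_along M \<sigma> X Y s = metric M c (cmap c (\<sigma> s)) (X c s) (Y c s)"
proof -
  define d where "d = (SOME d. d \<in> atlas M \<and> \<sigma> s \<in> cdom d)"
  have d: "d \<in> atlas M" "\<sigma> s \<in> cdom d"
    using someI[of "\<lambda>d. d \<in> atlas M \<and> \<sigma> s \<in> cdom d" c] c by (auto simp: d_def)
  have "cmap c (\<sigma> s) \<in> cmap c ` (cdom c \<inter> cdom d)" using c d by auto
  from metric_transition[OF c(1) d(1) this, of "X c s" "Y c s"] show ?thesis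
    by (simp add: inner_along_def Let_def X[OF d] Y[OF d] transition_cmap[OF smooth_M c] flip: d_def)
qed

text \<open>Supplies the vector law demanded by \<open>inner_along_eq\<close>: the chain rule for
  the velocity, then \<open>cov_transform\<close> twice for the third-order field.\<close>

lemma jet_transition:
  assumes c: "c \<in> atlas M" and d: "d \<in> atlas M"
    and J: "open J" "\<And>s. s \<in> J \<Longrightarrow> \<sigma> s \<in> cdom c"
    and x: "smooth_on J (cmap c \<circ> \<sigma>)" and s: "s \<in> J" "\<sigma> s \<in> cdom d"
  shows "velocity \<sigma> d s = frechet_derivative (transition c d) (at (cmap c (\<sigma> s))) (velocity \<sigma> c s)"
    "covariant_deriv M \<sigma> (tension M \<sigma>) d s =
      frechet_derivative (transition c d) (at (cmap c (\<sigma> s))) (covariant_deriv M \<sigma> (tension M \<sigma>) c s)"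
proof -
  define V where "V = cmap c ` (cdom c \<inter> cdom d)"
  define \<phi> where "\<phi> = transition c d"
  define x1 where "x1 = cmap c \<circ> \<sigma>"
  define x2 where "x2 = cmap d \<circ> \<sigma>"
  have V: "open V" "V \<subseteq> cmap c ` cdom c"
    unfolding V_def using open_overlap[OF smooth_M c d] by auto
  have \<phi>: "smooth_on V \<phi>" "\<phi> ` V \<subseteq> cmap d ` cdom d"
    unfolding V_def \<phi>_def using smooth_on_transition[OF smooth_M c d]
    by (auto simp: transition_cmap[OF smooth_M c])
  define J' where "J' = J \<inter> x1 -` V"
  have J': "open J'"
    unfolding J'_def Int_commute[of J]
    using smooth_on_continuous_on[OF x, folded x1_def] V(1)
    by (simp add: continuous_on_open_vimage[OF J(1)])
  have mem: "s \<in> J' \<longleftrightarrow> s \<in> J \<and> \<sigma> s \<in> cdom d" for s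
    using J(2) mem_overlap[OF smooth_M c, of "\<sigma> s" d] by (auto simp: J'_def V_def x1_def)
  have sJ': "s \<in> J'" using s mem by simp
  have x1: "smooth_on J' x1" unfolding x1_def by (rule smooth_on_mono[OF x]) (simp add: J'_def)
  have x12: "\<phi> (x1 s) = x2 s" if "s \<in> J'" for s
    using that mem J(2) by (simp add: \<phi>_def x1_def x2_def transition_cmap[OF smooth_M c])
  have x1V: "x1 s \<in> V" if "s \<in> J'" for s using that by (simp add: J'_def)
  have comp: "smooth_on J' (\<lambda>s. \<phi> (x1 s))"
    by (rule smooth_on_compose[OF J' V(1) _ x1 \<phi>(1)]) (use x1V in auto)
  have x2: "smooth_on J' x2" by (rule smooth_on_cong[OF J' x12 comp])
  note A = metric_chart_christoffel[OF M c] and B = metric_chart_christoffel[OF M d]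
  interpret A: metric_chart "cmap c ` cdom c" "christoffel M c" "metric M c" by (rule A)
  note iso = metric_transition[OF c d, folded V_def \<phi>_def]
  define G1 where "G1 = christoffel M c"
  define G2 where "G2 = christoffel M d"
  define S1 where "S1 = (\<lambda>s. frechet_derivative x1 (at s) 1)"
  define S2 where "S2 = (\<lambda>s. frechet_derivative x2 (at s) 1)"
  have S1: "smooth_on J' S1"
    unfolding S1_def by (intro smooth_on_frechet_derivative x1)
  have D2: "frechet_derivative x2 (at s) = frechet_derivative (\<lambda>s. \<phi> (x1 s)) (at s)" if s: "s \<in> J'" for s
    by (rule frechet_derivative_cong[OF J' _ s smooth_on_differentiable[OF comp s]]) (rule x12)
  have S12: "S2 s = frechet_derivative \<phi> (at (x1 s)) (S1 s)" if s: "s \<in> J'" for s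
    unfolding S1_def S2_def D2[OF s]
    by (rule fun_cong[OF frechet_derivative_eqI[OF has_derivative_compose[OF
            smooth_on_has_derivative[OF x1 s] smooth_on_has_derivative[OF \<phi>(1) x1V[OF s]]]]])
  have step: "cov G2 x2 1 Z2 s = frechet_derivative \<phi> (at (x1 s)) (cov G1 x1 1 Z1 s)"
    if Z1: "smooth_on J' Z1" and Z: "\<And>s. s \<in> J' \<Longrightarrow> Z2 s = frechet_derivative \<phi> (at (x1 s)) (Z1 s)"
      and s: "s \<in> J'" for Z1 Z2 s
  proof -
    note ct = cov_transform[OF A B V \<phi> iso smooth_on_differentiable[OF x1 s] x1V[OF s]
        smooth_on_differentiable[OF Z1 s]]
    have "cov G2 x2 1 Z2 s = cov G2 x2 1 (\<lambda>q. frechet_derivative \<phi> (at (x1 q)) (Z1 q)) s"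
      by (rule cov_cong[OF J' _ s ct(2)]) (rule Z[symmetric])
    also have "\<dots> = cov G2 (\<lambda>q. \<phi> (x1 q)) 1 (\<lambda>q. frechet_derivative \<phi> (at (x1 q)) (Z1 q)) s"
      unfolding cov_def D2[OF s] x12[OF s] ..
    also have "\<dots> = frechet_derivative \<phi> (at (x1 s)) (cov G1 x1 1 Z1 s)"
      unfolding G1_def G2_def by (rule ct(1))
    finally show ?thesis .
  qed
  have c1: "smooth_on J' (cov G1 x1 1 S1)"
    unfolding G1_def by (rule A.smooth_on_cov[OF J' x1 _ S1]) (use x1V V(2) in auto)
  have J'c: "\<sigma> s \<in> cdom c" "\<sigma> s \<in> cdom d" if "s \<in> J'" for s using that mem J(2) by auto
  have t1: "velocity \<sigma> c s = S1 s"
      "covariant_deriv M \<sigma> (tension M \<sigma>) c s = cov G1 x1 1 (cov G1 x1 1 S1) s"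
    unfolding S1_def x1_def G1_def
    by (rule tension_eq_cov[OF c J' J'c(1) x1[unfolded x1_def] sJ'], assumption)+
  have t2: "velocity \<sigma> d s = S2 s"
      "covariant_deriv M \<sigma> (tension M \<sigma>) d s = cov G2 x2 1 (cov G2 x2 1 S2) s"
    unfolding S2_def x2_def G2_def
    by (rule tension_eq_cov[OF d J' J'c(2) x2[unfolded x2_def] sJ'], assumption)+
  show "velocity \<sigma> d s = frechet_derivative (transition c d) (at (cmap c (\<sigma> s))) (velocity \<sigma> c s)"
    using S12[OF sJ'] by (simp add: t1 t2 \<phi>_def x1_def)
  show "covariant_deriv M \<sigma> (tension M \<sigma>) d s =
      frechet_derivative (transition c d) (at (cmap c (\<sigma> s))) (covariant_deriv M \<sigma> (tension M \<sigma>) c s)"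
    using step[OF c1 step[OF S1 S12] sJ'] by (simp add: t1 t2 \<phi>_def x1_def)
qed

text \<open>The energy density in a chart of choice. Nonnegativity of the metric is needed for the
  square to undo the square root in \<open>norm_along\<close>.\<close>

lemma norm_third_derivative:
  assumes c: "c \<in> atlas M" and J: "open J" "\<And>s. s \<in> J \<Longrightarrow> \<sigma> s \<in> cdom c"
    and x: "smooth_on J (cmap c \<circ> \<sigma>)" and s: "s \<in> J"
  defines "B \<equiv> cov (christoffel M c) (cmap c \<circ> \<sigma>) 1 (cov (christoffel M c) (cmap c \<circ> \<sigma>) 1
    (\<lambda>s. frechet_derivative (cmap c \<circ> \<sigma>) (at s) 1))"
  shows "(norm_along M \<sigma> (covariant_deriv M \<sigma> (tension M \<sigma>)) s)\<^sup>2 =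
    metric M c (cmap c (\<sigma> s)) (B s) (B s)"
proof -
  interpret metric_chart "cmap c ` cdom c" "christoffel M c" "metric M c"
    by (rule metric_chart_christoffel[OF M c])
  have U: "cmap c (\<sigma> s) \<in> cmap c ` cdom c" using J(2)[OF s] by simp
  have B: "B s = covariant_deriv M \<sigma> (tension M \<sigma>) c s"
    unfolding B_def by (rule tension_eq_cov(3)[OF c J x s, symmetric])
  have "inner_along M \<sigma> (covariant_deriv M \<sigma> (tension M \<sigma>)) (covariant_deriv M \<sigma> (tension M \<sigma>)) s =
      metric M c (cmap c (\<sigma> s)) (B s) (B s)"
    unfolding B
    by (rule inner_along_eq[of c \<sigma> s, OF c J(2)[OF s]]; rule jet_transition(2)[OF c _ J x s])
  moreover have "metric M c (cmap c (\<sigma> s)) (B s) (B s) \<ge> 0"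
    using pos_def[OF U, of "B s"] bilinear_lzero[OF smooth_bilinear_on_bilinear[OF smooth_metric U]]
    by (cases "B s = 0") auto
  ultimately show ?thesis by (simp add: norm_along_def)
qed

end

section \<open>Bump functions\<close>

text \<open>
  The derivatives of \<open>exp (- 1 / x)\<close> are linear combinations of members of this family, so that
  smoothness of all members follows by one induction.
\<close>

definition flat_exp :: "nat \<Rightarrow> real \<Rightarrow> real" where
  "flat_exp n x = (if x > 0 then inverse x ^ n * exp (- inverse x) else 0)"

lemma flat_exp_tendsto_0: "(flat_exp n \<longlongrightarrow> 0) (at_right 0)"
proof -
  have "((\<lambda>x. inverse x ^ n / exp (inverse x)) \<longlongrightarrow> (0::real)) (at_right 0)"
    by (rule filterlim_compose[OF tendsto_power_div_exp_0 filterlim_inverse_at_top_right])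
  moreover have "\<forall>\<^sub>F x in at_right 0. inverse x ^ n / exp (inverse x) = flat_exp n x"
    by (rule eventually_at_right_less[THEN eventually_mono]) (simp add: flat_exp_def exp_minus field_simps)
  ultimately show ?thesis by (rule Lim_transform_eventually)
qed

lemma flat_exp_has_derivative:
  "(flat_exp n has_real_derivative flat_exp (n + 2) x - n * flat_exp (n + 1) x) (at x)"
proof -
  consider "x > 0" | "x < 0" | "x = 0" by linarith
  then show ?thesis
  proof cases
    case 1
    \<comment> \<open>For n = 0 the exponent is truncated, but then the factor \<open>real n\<close>
      vanishes.\<close>
    have n: "real n * y ^ (n - Suc 0) * y\<^sup>2 = real n * y ^ (n + 1)" for y :: real
      by (cases n) (simp_all add: power2_eq_square)
    have "((\<lambda>x. inverse x ^ n * exp (- inverse x)) has_real_derivative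
        inverse x ^ n * (exp (- inverse x) * inverse x ^ 2) - real n * inverse x ^ (n + 1) * exp (- inverse x)) (at x)"
      using 1 n[of "inverse x"] by (auto intro!: derivative_eq_intros simp: power2_eq_square algebra_simps)
    then have "((\<lambda>x. inverse x ^ n * exp (- inverse x)) has_real_derivative
        flat_exp (n + 2) x - n * flat_exp (n + 1) x) (at x)"
      using 1 by (simp add: flat_exp_def power_add power2_eq_square algebra_simps)
    then show ?thesis
      by (rule has_field_derivative_transform_within_open[where S = "{0<..}"])
        (use 1 in \<open>auto simp: flat_exp_def\<close>)
  next
    case 2
    have "((\<lambda>x. 0) has_real_derivative 0) (at x)" by simp
    then have "(flat_exp n has_real_derivative 0) (at x)"
      by (rule has_field_derivative_transform_within_open[where S = "{..<0}"])
        (use 2 in \<open>auto simp: flat_exp_def\<close>)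
    then show ?thesis using 2 by (simp add: flat_exp_def)
  next
    case 3
    \<comment> \<open>From the right the difference quotient at 0 is the next member of the family,
      which tends to 0; from the left it is identically 0.\<close>
    have "((\<lambda>t. flat_exp n t / t) \<longlongrightarrow> 0) (at_right 0)"
      by (rule Lim_transform_eventually[OF flat_exp_tendsto_0[of "Suc n"]])
        (rule eventually_at_right_less[THEN eventually_mono], simp add: flat_exp_def field_simps)
    moreover have "\<forall>\<^sub>F t in at_left (0::real). 0 = flat_exp n t / t"
      by (auto simp: eventually_at_left_field flat_exp_def intro!: exI[of _ "-1"])
    then have "((\<lambda>t. flat_exp n t / t) \<longlongrightarrow> 0) (at_left 0)"
      by (rule Lim_transform_eventually[OF tendsto_const])
    ultimately have "((\<lambda>t. flat_exp n t / t) \<longlongrightarrow> 0) (at 0)"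
      using filterlim_split_at by blast
    then show ?thesis
      unfolding 3 DERIV_def by (simp add: flat_exp_def)
  qed
qed

lemma smooth_on_flat_exp: "smooth_on UNIV (flat_exp n)"
  unfolding smooth_on_def
proof
  fix k show "Ck_on k UNIV (flat_exp n)"
  proof (induction k arbitrary: n)
    case 0
    show ?case unfolding Ck_on.simps
      by (rule DERIV_continuous_on[OF has_field_derivative_at_within[OF flat_exp_has_derivative]])
  next
    case (Suc k)
    have "(flat_exp n has_derivative (\<lambda>v. v * (flat_exp (n + 2) x + (- real n) * flat_exp (n + 1) x))) (at x)" for x
      using flat_exp_has_derivative[of n x] unfolding has_field_derivative_def
      by (simp add: mult_commute_abs)
    then show ?case
      by (rule Ck_on_SucI[OF open_UNIV])
        (intro Ck_on_bounded_bilinear[OF bounded_bilinear_mult] Ck_on_add Ck_on_const open_UNIV Suc.IH)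
  qed
qed

lemma smooth_bump_exists:
  fixes p q :: real
  shows "\<exists>\<psi>::real \<Rightarrow> real. smooth_on UNIV \<psi> \<and> (\<forall>s. \<psi> s \<ge> 0) \<and>
    (\<forall>s. p < s \<and> s < q \<longrightarrow> \<psi> s > 0) \<and> (\<forall>s. s \<le> p \<or> q \<le> s \<longrightarrow> \<psi> s = 0)"
proof -
  define \<psi> where "\<psi> s = flat_exp 0 (s - p) * flat_exp 0 (q - s)" for s
  have "smooth_on UNIV \<psi>"
    unfolding \<psi>_def
    by (intro smooth_on_mult open_UNIV smooth_on_compose[OF open_UNIV open_UNIV subset_UNIV _ smooth_on_flat_exp]
        smooth_on_diff smooth_on_const smooth_on_ident)
  moreover have "\<psi> s \<ge> 0" "p < s \<and> s < q \<longrightarrow> \<psi> s > 0" "s \<le> p \<or> q \<le> s \<longrightarrow> \<psi> s = 0" for s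
    by (auto simp: \<psi>_def flat_exp_def)
  ultimately show ?thesis by (intro exI[of _ \<psi>]) simp
qed

section \<open>Variations supported in a chart\<close>

context
  fixes M :: "('a, 'e::euclidean_space) manifold"
  assumes M: "smooth_manifold M"
begin

lemma open_curve_preimage:
  assumes "open I" "smooth_into M I \<gamma>" "openin (top_of M) W"
  shows "open {s\<in>I. \<gamma> s \<in> W}"
proof -
  have "openin (top_of_set I) {s\<in>I. \<gamma> s \<in> W}"
    using assms(2,3) unfolding smooth_into_def continuous_map_def by auto
  then show ?thesis using assms(1) by (auto simp: openin_open_eq)
qed

text \<open>The affine motion in the chart is glued to the resting curve. The domains of the two
  formulas, parameters in the chart and parameters outside \<open>K\<close>, are open and cover
  \<open>I\<close>; on their overlap \<eta> vanishes, so the formulas agree.\<close>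

lemma chart_variation:
  fixes \<gamma> :: "real \<Rightarrow> 'a"
  assumes I: "open I" and \<gamma>: "smooth_into M I \<gamma>" and c: "c \<in> atlas M"
    and K: "compact K" and \<eta>: "smooth_on {s\<in>I. \<gamma> s \<in> cdom c} \<eta>"
    and supp: "K \<subseteq> {s\<in>I. \<gamma> s \<in> cdom c}" "\<And>s. s \<notin> K \<Longrightarrow> \<eta> s = 0"
    and \<epsilon>: "\<epsilon> > 0" "\<And>t s. \<bar>t\<bar> < \<epsilon> \<Longrightarrow> s \<in> I \<Longrightarrow> \<gamma> s \<in> cdom c \<Longrightarrow> cmap c (\<gamma> s) + t *\<^sub>R \<eta> s \<in> cmap c ` cdom c"
  shows "\<exists>\<Phi>. variation_supported_in M I \<gamma> K \<epsilon> \<Phi> \<and>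
    (\<forall>t s. \<bar>t\<bar> < \<epsilon> \<and> s \<in> I \<and> \<gamma> s \<in> cdom c \<longrightarrow>
      \<Phi> t s \<in> cdom c \<and> cmap c (\<Phi> t s) = cmap c (\<gamma> s) + t *\<^sub>R \<eta> s)"
proof -
  define J where "J = {s\<in>I. \<gamma> s \<in> cdom c}"
  define x where "x = cmap c \<circ> \<gamma>"
  define E where "E = {-\<epsilon><..<\<epsilon>}"
  define y where "y q = x (snd q) + fst q *\<^sub>R \<eta> (snd q)" for q
  define \<Phi> where "\<Phi> t s = (if s \<in> J then inv_into (cdom c) (cmap c) (y (t, s)) else \<gamma> s)" for t s
  have E: "open E" "t \<in> E \<longleftrightarrow> \<bar>t\<bar> < \<epsilon>" for t by (auto simp: E_def)
  have J: "open J" unfolding J_def by (rule open_curve_preimage[OF I \<gamma> chart_open(1)[OF M c]])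
  have x: "smooth_on J x" using \<gamma> c by (simp add: smooth_into_def J_def x_def)
  have EJ: "open (E \<times> J)" using E J by (simp add: open_Times)
  have comp_snd: "smooth_on (A \<times> B) (\<lambda>q. h (snd q))" if "open A" "open B" "smooth_on B h"
    for A B :: "real set" and h :: "real \<Rightarrow> 'e"
    by (rule smooth_on_compose[OF open_Times[OF that(1,2)] that(2) _ smooth_on_snd[OF open_Times[OF that(1,2)]] that(3)])
      auto
  have y: "smooth_on (E \<times> J) y"
    unfolding y_def
    by (intro smooth_on_add smooth_on_scaleR EJ smooth_on_fst comp_snd E J x \<eta>[folded J_def])
  have yU: "y (t, s) \<in> cmap c ` cdom c" if "t \<in> E" "s \<in> J" for t s
    using \<epsilon>(2)[of t s] that E by (auto simp: y_def x_def J_def)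
  note inj = chart_open(3)[OF M c]
  have \<Phi>J: "\<Phi> t s \<in> cdom c" "cmap c (\<Phi> t s) = y (t, s)" if "t \<in> E" "s \<in> J" for t s
    using yU[OF that] that by (auto simp: \<Phi>_def intro: inv_into_into f_inv_into_f)
  have \<Phi>_off: "\<Phi> t s = \<gamma> s" if "t = 0 \<or> s \<notin> K" for t s
    using that supp(2) by (auto simp: \<Phi>_def y_def x_def J_def inv_into_f_f[OF inj])
  have cover: "s \<in> J \<or> s \<in> I - K" if "s \<in> I" for s
    using that supp(1) by (auto simp: J_def)
  have JI: "J \<subseteq> I" by (auto simp: J_def)
  have track: "\<Phi> t s \<in> cdom c \<and> cmap c (\<Phi> t s) = cmap c (\<gamma> s) + t *\<^sub>R \<eta> s"
    if "\<bar>t\<bar> < \<epsilon>" "s \<in> I" "\<gamma> s \<in> cdom c" for t s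
    using \<Phi>J[of t s] that E by (auto simp: J_def y_def x_def)
  have open1: "open ((E \<times> J) \<inter> y -` V)" if "open V" for V
    using smooth_on_continuous_on[OF y] that continuous_on_open_vimage[OF EJ, of y]
    by (auto simp: Int_commute)
  have open2: "open (E \<times> ({s\<in>I. \<gamma> s \<in> W} - K))" if "openin (top_of M) W" for W
    by (intro open_Times E(1) open_Diff open_curve_preimage[OF I \<gamma> that] compact_imp_closed K)
  have mem1: "q \<in> (E \<times> J) \<inter> y -` (cmap c ` (cdom c \<inter> W)) \<longleftrightarrow> q \<in> E \<times> J \<and> \<Phi> (fst q) (snd q) \<in> W" for q W
  proof (cases q)
    case (Pair t s)
    show ?thesis
    proof (cases "t \<in> E \<and> s \<in> J")
      case True
      then have "\<Phi> t s \<in> cdom c" "y (t, s) = cmap c (\<Phi> t s)" using \<Phi>J by auto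
      then show ?thesis using True Pair inj by (auto simp: inj_on_def)
    qed (use Pair in auto)
  qed
  have "continuous_map (top_of_set (E \<times> I)) (top_of M) (\<lambda>(t, s). \<Phi> t s)"
    unfolding continuous_map_def
  proof (intro conjI allI impI)
    have "\<gamma> s \<in> topspace (top_of M)" if "s \<in> I" for s
      using \<gamma> that by (auto simp: smooth_into_def continuous_map_def)
    moreover have "cdom c \<subseteq> topspace (top_of M)" by (rule openin_subset[OF chart_open(1)[OF M c]])
    ultimately have "\<Phi> t s \<in> topspace (top_of M)" if "t \<in> E" "s \<in> I" for t s
      using \<Phi>J(1)[OF that(1)] that \<Phi>_def by (cases "s \<in> J") auto
    then show "(\<lambda>(t, s). \<Phi> t s) \<in> topspace (top_of_set (E \<times> I)) \<rightarrow> topspace (top_of M)" by auto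
    fix W assume W: "openin (top_of M) W"
    \<comment> \<open>The preimage splits along these two pieces: one part is controlled by the
      affine formula, the other by continuity of \<gamma>. Closedness of \<open>K\<close> makes the
      second part open.\<close>
    have "{q \<in> topspace (top_of_set (E \<times> I)). (case q of (t, s) \<Rightarrow> \<Phi> t s) \<in> W} =
        ((E \<times> J) \<inter> y -` (cmap c ` (cdom c \<inter> W))) \<union> (E \<times> ({s\<in>I. \<gamma> s \<in> W} - K))"
      using cover JI \<Phi>_off unfolding set_eq_iff Un_iff mem1 by fastforce
    moreover have "open \<dots>"
      by (intro open_Un open1 open2 open_chart_image[OF M c W] W)
    ultimately show "openin (top_of_set (E \<times> I)) {q \<in> topspace (top_of_set (E \<times> I)). (case q of (t, s) \<Rightarrow> \<Phi> t s) \<in> W}"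
      using E I by (auto simp: openin_open_eq open_Times)
  qed
  moreover have "smooth_on {q \<in> E \<times> I. (case q of (t, s) \<Rightarrow> \<Phi> t s) \<in> cdom d} (cmap d \<circ> (\<lambda>(t, s). \<Phi> t s))"
    if d: "d \<in> atlas M" for d
  proof (rule smooth_on_local)
    fix q assume "q \<in> {q \<in> E \<times> I. (case q of (t, s) \<Rightarrow> \<Phi> t s) \<in> cdom d}"
    then obtain t s where q: "q = (t, s)" "t \<in> E" "s \<in> I" "\<Phi> t s \<in> cdom d" by auto
    show "\<exists>Q. open Q \<and> q \<in> Q \<and> smooth_on Q (cmap d \<circ> (\<lambda>(t, s). \<Phi> t s))"
    proof (cases "s \<in> J")
      case True
      define V where "V = cmap c ` (cdom c \<inter> cdom d)"
      define Q where "Q = (E \<times> J) \<inter> y -` V"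
      have V: "open V" unfolding V_def by (rule open_overlap[OF M c d])
      have Q: "open Q" unfolding Q_def by (rule open1[OF V])
      have "smooth_on Q (\<lambda>q. transition c d (y q))"
        by (rule smooth_on_compose[OF Q V _ smooth_on_mono[OF y] smooth_on_transition[OF M c d, folded V_def]])
          (auto simp: Q_def)
      then have "smooth_on Q (cmap d \<circ> (\<lambda>(t, s). \<Phi> t s))"
        by (rule smooth_on_cong[OF Q, rotated])
          (auto simp: Q_def \<Phi>J(2)[symmetric] transition_cmap[OF M c \<Phi>J(1)])
      moreover have "q \<in> Q" unfolding Q_def V_def mem1 using q True by simp
      ultimately show ?thesis using Q by blast
    next
      case False
      define Q where "Q = E \<times> ({s\<in>I. \<gamma> s \<in> cdom d} - K)"
      have Q: "open Q" unfolding Q_def by (rule open2[OF chart_open(1)[OF M d]])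
      have oB: "open ({s\<in>I. \<gamma> s \<in> cdom d} - K)"
        by (intro open_Diff open_curve_preimage[OF I \<gamma> chart_open(1)[OF M d]] compact_imp_closed K)
      have sm: "smooth_on {s\<in>I. \<gamma> s \<in> cdom d} (cmap d \<circ> \<gamma>)" using \<gamma> d by (simp add: smooth_into_def)
      have "smooth_on Q (\<lambda>q. (cmap d \<circ> \<gamma>) (snd q))"
        unfolding Q_def by (rule comp_snd[OF E(1) oB smooth_on_mono[OF sm]]) auto
      then have "smooth_on Q (cmap d \<circ> (\<lambda>(t, s). \<Phi> t s))"
        by (rule smooth_on_cong[OF Q, rotated]) (auto simp: Q_def \<Phi>_off)
      moreover have "s \<notin> K" using cover[OF q(3)] False by blast
      then have "q \<in> Q" using q \<Phi>_off[of t s] by (auto simp: Q_def)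
      ultimately show ?thesis using Q by blast
    qed
  qed
  ultimately have "smooth_into M (E \<times> I) (\<lambda>(t, s). \<Phi> t s)"
    by (simp add: smooth_into_def)
  then have "variation_supported_in M I \<gamma> K \<epsilon> \<Phi>"
    using \<epsilon>(1) \<Phi>_off by (simp add: variation_supported_in_def E_def)
  with track show ?thesis by (intro exI[of _ \<Phi>]) simp
qed

end

section \<open>First variation of the weighted 3-energy\<close>

text \<open>Differentiation under the integral sign. Only \<open>D\<close> is differentiated, so
  continuity of the weight is enough.\<close>

lemma weighted_integral_has_derivative:
  fixes f :: "real \<Rightarrow> real" and D :: "real \<times> real \<Rightarrow> real"
  assumes P: "open P" "{-\<epsilon><..<\<epsilon>} \<times> {a..b} \<subseteq> P" and D: "smooth_on P D"
    and f: "continuous_on {a..b} f" and \<epsilon>: "\<epsilon> > 0"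
  shows "((\<lambda>t. integral {a..b} (\<lambda>s. f s * D (t, s))) has_real_derivative
    integral {a..b} (\<lambda>s. f s * frechet_derivative D (at (0, s)) (1, 0))) (at 0)"
proof -
  define E where "E = {-\<epsilon><..<\<epsilon>}"
  have cont: "continuous_on (E \<times> cbox a b) Z" if "smooth_on P Z" for Z :: "real \<times> real \<Rightarrow> real"
    using continuous_on_subset[OF smooth_on_continuous_on[OF that]] P(2) by (simp add: E_def)
  have slice: "((\<lambda>t. D (t, s)) has_real_derivative frechet_derivative D (at (t, s)) (1, 0)) (at t)"
    if "t \<in> E" "s \<in> cbox a b" for t s
  proof -
    have "(t, s) \<in> P" using that P(2) by (auto simp: E_def)
    from smooth_on_has_derivative[OF D this]
    have "(D has_derivative frechet_derivative D (at (t, s))) (at ((0, s) + t *\<^sub>R (1, 0)))" by simp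
    from has_derivative_along_line[OF this] show ?thesis by simp
  qed
  have "((\<lambda>t. integral (cbox a b) (\<lambda>s. f s * D (t, s))) has_real_derivative
    integral (cbox a b) (\<lambda>s. f s * frechet_derivative D (at (0, s)) (1, 0))) (at 0 within E)"
  proof (rule leibniz_rule_field_derivative[where fx = "\<lambda>t s. f s * frechet_derivative D (at (t, s)) (1, 0)"])
    show "((\<lambda>t. f s * D (t, s)) has_real_derivative f s * frechet_derivative D (at (t, s)) (1, 0)) (at t within E)"
      if "t \<in> E" "s \<in> cbox a b" for t s
      by (rule has_field_derivative_at_within[OF DERIV_cmult[OF slice[OF that]]])
    show "(\<lambda>s. f s * D (t, s)) integrable_on cbox a b" if "t \<in> E" for t
    proof (rule integrable_continuous)
      have "continuous_on (cbox a b) (\<lambda>s. D (t, s))"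
        by (rule continuous_on_compose2[OF cont[OF D]]) (use that in \<open>auto intro!: continuous_intros\<close>)
      then show "continuous_on (cbox a b) (\<lambda>s. f s * D (t, s))"
        using f by (auto intro: continuous_on_mult)
    qed
    have "continuous_on (E \<times> cbox a b) (\<lambda>q. f (snd q) * frechet_derivative D (at q) (1, 0))"
      by (intro continuous_on_mult cont[OF smooth_on_frechet_derivative[OF D]]
          continuous_on_compose2[OF f continuous_on_snd]) (auto intro: continuous_intros)
    then show "continuous_on (E \<times> cbox a b) (\<lambda>(t, s). f s * frechet_derivative D (at (t, s)) (1, 0))"
      by (simp add: case_prod_unfold)
    show "0 \<in> E" "convex E" using \<epsilon> by (auto simp: E_def)
  qed
  then show ?thesis
    using \<epsilon> at_within_open[of 0 E] by (simp add: E_def)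
qed

text \<open>
  Subtracting the derivative of
  \<open>f \<alpha>'' - f' \<alpha>' + f'' \<alpha> - 3 k\<^sup>2 f \<alpha> - 3 k (f \<beta>' - f' \<beta>)\<close>, which vanishes at the end points.
\<close>

lemma integrate_by_parts:
  fixes f \<alpha> \<beta> :: "real \<Rightarrow> real"
  assumes "a \<le> b"
    and f: "\<And>s. s \<in> {a..b} \<Longrightarrow> (f has_real_derivative f1 s) (at s)"
      "\<And>s. s \<in> {a..b} \<Longrightarrow> (f1 has_real_derivative f2 s) (at s)"
      "\<And>s. s \<in> {a..b} \<Longrightarrow> (f2 has_real_derivative f3 s) (at s)"
    and \<alpha>: "\<And>s. s \<in> {a..b} \<Longrightarrow> (\<alpha> has_real_derivative \<alpha>1 s) (at s)"
      "\<And>s. s \<in> {a..b} \<Longrightarrow> (\<alpha>1 has_real_derivative \<alpha>2 s) (at s)"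
      "\<And>s. s \<in> {a..b} \<Longrightarrow> (\<alpha>2 has_real_derivative \<alpha>3 s) (at s)"
    and \<beta>: "\<And>s. s \<in> {a..b} \<Longrightarrow> (\<beta> has_real_derivative \<beta>1 s) (at s)"
      "\<And>s. s \<in> {a..b} \<Longrightarrow> (\<beta>1 has_real_derivative \<beta>2 s) (at s)"
    and ends: "\<And>s. s \<in> {a, b} \<Longrightarrow> \<alpha> s = 0 \<and> \<alpha>1 s = 0 \<and> \<alpha>2 s = 0 \<and> \<beta> s = 0 \<and> \<beta>1 s = 0"
    and int: "((\<lambda>s. f s * (\<alpha>3 s - 3 * k * \<beta>2 s - 3 * k\<^sup>2 * \<alpha>1 s + m * \<beta> s)) has_integral 0) {a..b}"
  shows "((\<lambda>s. \<alpha> s * (3 * k\<^sup>2 * f1 s - f3 s) + \<beta> s * (m * f s - 3 * k * f2 s)) has_integral 0) {a..b}"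
proof -
  define F where "F s = f s * \<alpha>2 s - f1 s * \<alpha>1 s + f2 s * \<alpha> s - 3 * k\<^sup>2 * (f s * \<alpha> s)
    - 3 * k * (f s * \<beta>1 s - f1 s * \<beta> s)" for s
  define F' where "F' s = f s * \<alpha>3 s + f3 s * \<alpha> s - 3 * k\<^sup>2 * (f s * \<alpha>1 s + f1 s * \<alpha> s)
    - 3 * k * (f s * \<beta>2 s - f2 s * \<beta> s)" for s
  have "(F has_real_derivative F' s) (at s)" if "s \<in> {a..b}" for s
    unfolding F_def F'_def using f[OF that] \<alpha>[OF that] \<beta>[OF that]
    by (auto intro!: derivative_eq_intros simp: algebra_simps)
  then have "(F' has_integral (F b - F a)) {a..b}"
    by (intro fundamental_theorem_of_calculus \<open>a \<le> b\<close>)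
      (auto simp: has_real_derivative_iff_has_vector_derivative[symmetric] intro: has_field_derivative_at_within)
  then have "(F' has_integral 0) {a..b}" using ends[of a] ends[of b] by (simp add: F_def)
  from has_integral_diff[OF int this] show ?thesis
    by (simp add: F'_def algebra_simps)
qed

text \<open>Presents the densities of all curves of a variation as one function of time and
  parameter, built from covariant derivatives of \<open>y\<close>. In this form it is smooth and can
  be differentiated in time.\<close>

lemma norm_third_derivative_family:
  fixes M :: "('a, real^2) manifold" and y :: "real \<times> real \<Rightarrow> real^2"
  assumes M: "riemannian_manifold M" and c: "c \<in> atlas M"
    and P: "open P" and y: "smooth_on P y" "y ` P \<subseteq> cmap c ` cdom c"
    and J: "open J" "\<And>s. s \<in> J \<Longrightarrow> (t, s) \<in> P"
    and \<sigma>: "\<And>s. s \<in> J \<Longrightarrow> \<sigma> s \<in> cdom c \<and> cmap c (\<sigma> s) = y (t, s)"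
    and s: "s \<in> J"
  defines "B \<equiv> cov (christoffel M c) y (0, 1) (cov (christoffel M c) y (0, 1)
    (\<lambda>q. frechet_derivative y (at q) (0, 1)))"
  shows "(norm_along M \<sigma> (covariant_deriv M \<sigma> (tension M \<sigma>)) s)\<^sup>2 =
    metric M c (y (t, s)) (B (t, s)) (B (t, s))"
proof -
  interpret metric_chart "cmap c ` cdom c" "christoffel M c" "metric M c"
    by (rule metric_chart_christoffel[OF M c])
  define G where "G = christoffel M c"
  define x where "x = cmap c \<circ> \<sigma>"
  define S where "S = (\<lambda>q. frechet_derivative y (at q) (0, 1))"
  have slice: "smooth_on J (\<lambda>s. Z (t, s))" if "smooth_on P Z" for Z :: "real \<times> real \<Rightarrow> real^2"
    by (rule smooth_on_compose[OF J(1) P _ _ that])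
      (use J in \<open>auto intro!: smooth_on_Pair smooth_on_const smooth_on_ident\<close>)
  have yx: "y (t, s) = x s" if "s \<in> J" for s using \<sigma>[OF that] by (simp add: x_def)
  have x: "smooth_on J x" by (rule smooth_on_cong[OF J(1) yx slice[OF y(1)]])
  have d: "frechet_derivative W (at s) 1 = frechet_derivative Z (at (t, s)) (0, 1)"
    if Z: "smooth_on P Z" and W: "\<And>s. s \<in> J \<Longrightarrow> Z (t, s) = W s" and s: "s \<in> J"
    for Z :: "real \<times> real \<Rightarrow> real^2" and W s
    using frechet_derivative_cong[OF J(1) W s smooth_on_differentiable[OF slice[OF Z] s]]
      frechet_derivative_slice[OF smooth_on_differentiable[OF Z J(2)[OF s]], of 1] by simp
  have S: "smooth_on P S" unfolding S_def by (intro smooth_on_frechet_derivative y)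
  note cS = smooth_on_cov[OF P y S, folded G_def]
  have step: "cov G y (0, 1) Z (t, s) = cov G x 1 W s"
    if "smooth_on P Z" "\<And>s. s \<in> J \<Longrightarrow> Z (t, s) = W s" "s \<in> J" for Z W s
    using d[OF that] d[OF y(1) yx that(3)] that(2,3) yx by (simp add: cov_def)
  have "S (t, s) = frechet_derivative x (at s) 1" if "s \<in> J" for s
    using d[OF y(1) yx that] by (simp add: S_def)
  note B = step[OF cS step[OF S this] s]
  show ?thesis
    using norm_third_derivative[OF M c J(1) _ x[unfolded x_def] s] \<sigma> B yx[OF s]
    by (simp add: B_def S_def G_def x_def)
qed

lemma smooth_on_DERIV:
  fixes f :: "real \<Rightarrow> real"
  assumes "smooth_on S f" "s \<in> S"
  shows "(f has_real_derivative frechet_derivative f (at s) 1) (at s)"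
  using has_derivative_along_line[of f "frechet_derivative f (at s)" 0 s 1]
    smooth_on_has_derivative[OF assms] by simp

lemma frechet_derivative_zero_on:
  assumes "open S" "\<And>s. s \<in> S \<Longrightarrow> f s = 0" "s \<in> S"
  shows "frechet_derivative f (at s) v = 0"
  using frechet_derivative_cong[OF assms(1), of "\<lambda>_. 0" f s] assms by simp

section \<open>Curves of constant curvature\<close>

text \<open>A single variation is tested. Its coefficients are the two Euler-Lagrange expressions
  themselves, cut off by a bump function, so criticality makes the integral of a nonnegative
  function vanish and arbitrary test functions are avoided.\<close>

lemma constant_curvature_identity:
  fixes M :: "('a, real^2) manifold"
  assumes M: "riemannian_manifold M" and C: "constant_sectional_curvature M C"
    and I: "open I" and f: "smooth_on I f" and \<gamma>: "smooth_into M I \<gamma>"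
    and harm: "f_3_harmonic M I f \<gamma>" and geo: "has_geodesic_curvature M I \<gamma> \<kappa>"
    and \<kappa>: "\<And>s. s \<in> I \<Longrightarrow> \<kappa> s = k" and k: "k > 0"
    and s0: "s0 \<in> I" and f': "frechet_derivative f (at s0) 1 \<noteq> 0"
  shows "C = - 4 * k\<^sup>2"
proof -
  have sM: "smooth_manifold M" using M by (simp add: riemannian_manifold_def)
  obtain N where N: "smooth_vfield_along M I \<gamma> N"
    and inn: "\<And>s. s \<in> I \<Longrightarrow> inner_along M \<gamma> (velocity \<gamma>) (velocity \<gamma>) s = 1"
      "\<And>s. s \<in> I \<Longrightarrow> inner_along M \<gamma> N N s = 1"
      "\<And>s. s \<in> I \<Longrightarrow> inner_along M \<gamma> (velocity \<gamma>) N s = 0"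
    and fr: "vfield_eq M I \<gamma> (covariant_deriv M \<gamma> (velocity \<gamma>)) (\<lambda>c s. \<kappa> s *\<^sub>R N c s)"
      "vfield_eq M I \<gamma> (covariant_deriv M \<gamma> N) (\<lambda>c s. - \<kappa> s *\<^sub>R velocity \<gamma> c s)"
    using geo unfolding has_geodesic_curvature_def by blast
  have "\<gamma> s0 \<in> topspace (top_of M)"
    using \<gamma> s0 by (auto simp: smooth_into_def continuous_map_def)
  then obtain c where c: "c \<in> atlas M" "\<gamma> s0 \<in> cdom c"
    using sM unfolding smooth_manifold_def by blast
  define U where "U = cmap c ` cdom c"
  define G where "G = christoffel M c"
  define g where "g = metric M c"
  interpret metric_chart U G g
    unfolding U_def G_def g_def by (rule metric_chart_christoffel[OF M c(1)])
  define J where "J = {s\<in>I. \<gamma> s \<in> cdom c}"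
  define x where "x = cmap c \<circ> \<gamma>"
  define T where "T = (\<lambda>s. frechet_derivative x (at s) 1)"
  define n where "n = N c"
  have J: "open J" unfolding J_def by (rule open_curve_preimage[OF sM I \<gamma> chart_open(1)[OF sM c(1)]])
  have JI: "J \<subseteq> I" and Jc: "\<And>s. s \<in> J \<Longrightarrow> \<gamma> s \<in> cdom c" and s0J: "s0 \<in> J"
    using s0 c by (auto simp: J_def)
  have x: "smooth_on J x" using \<gamma> c(1) by (simp add: smooth_into_def J_def x_def)
  have xU: "x s \<in> U" if "s \<in> J" for s using Jc[OF that] by (simp add: x_def U_def)
  have n: "smooth_on J n" using N c(1) by (simp add: smooth_vfield_along_def J_def n_def)
  have T: "smooth_on J T" unfolding T_def by (rule smooth_on_frechet_derivative[OF x])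
  have vel: "velocity \<gamma> c s = T s" and ten: "tension M \<gamma> c s = cov G x 1 T s" if "s \<in> J" for s
    using tension_eq_cov(1,2)[OF M c(1) J Jc x[unfolded x_def] that]
    by (simp_all add: T_def G_def x_def)
  have velt: "velocity \<gamma> d s = frechet_derivative (transition c d) (at (cmap c (\<gamma> s))) (velocity \<gamma> c s)"
    if "s \<in> J" "d \<in> atlas M" "\<gamma> s \<in> cdom d" for d s
    by (rule jet_transition(1)[OF M c(1) that(2) J Jc x[unfolded x_def] that(1,3)])
  have Nt: "N d s = frechet_derivative (transition c d) (at (cmap c (\<gamma> s))) (N c s)"
    if "s \<in> J" "d \<in> atlas M" "\<gamma> s \<in> cdom d" for d s
    using N c(1) that Jc[OF that(1)] JI unfolding smooth_vfield_along_def by blast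
  have on: "g (x s) (T s) (T s) = 1" "g (x s) (n s) (n s) = 1" "g (x s) (T s) (n s) = 0" if s: "s \<in> J" for s
  proof -
    have sI: "s \<in> I" using s JI by auto
    note e = inner_along_eq[where c = c and \<sigma> = \<gamma> and s = s, OF M c(1) Jc[OF s]]
    note ev = velt[OF s] and en = Nt[OF s]
    show "g (x s) (T s) (T s) = 1"
      using e[where X = "velocity \<gamma>" and Y = "velocity \<gamma>", OF ev ev] inn(1)[OF sI] by (simp add: vel[OF s] g_def x_def)
    show "g (x s) (n s) (n s) = 1"
      using e[where X = N and Y = N, OF en en] inn(2)[OF sI] by (simp add: n_def g_def x_def)
    show "g (x s) (T s) (n s) = 0"
      using e[where X = "velocity \<gamma>" and Y = N, OF ev en] inn(3)[OF sI] by (simp add: vel[OF s] n_def g_def x_def)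
  qed
  have frenet: "cov G x 1 T s = k *\<^sub>R n s" "cov G x 1 n s = - k *\<^sub>R T s" if s: "s \<in> J" for s
  proof -
    have sI: "s \<in> I" using s JI by auto
    show "cov G x 1 T s = k *\<^sub>R n s"
      using fr(1) c(1) sI Jc[OF s] ten[OF s] \<kappa>[OF sI]
      unfolding vfield_eq_def tension_def by (simp add: n_def)
    have "covariant_deriv M \<gamma> N c s = cov G x 1 n s"
      unfolding G_def x_def n_def
      by (rule covariant_deriv_eq_cov[where c = c and \<sigma> = \<gamma> and X = N, OF M smooth_on_differentiable[OF x[unfolded x_def] s]
            smooth_on_differentiable[OF n[unfolded n_def] s]])
    then show "cov G x 1 n s = - k *\<^sub>R T s"
      using fr(2) c(1) sI Jc[OF s] \<kappa>[OF sI] vel[OF s] unfolding vfield_eq_def by simp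
  qed
  have K: "g z (curv G z u v v) u / (g z u u * g z v v - (g z u v)\<^sup>2) = C"
    if "z \<in> U" "u \<noteq> v \<and> independent {u, v}" for z u v
    using C c(1) that unfolding constant_sectional_curvature_def sectional_curvature_def
      curvature_tensor_def curv_def dbilin_def U_def G_def g_def by blast
  obtain r where r: "r > 0" "cball s0 r \<subseteq> J"
    using J s0J open_contains_cball by blast
  \<comment> \<open>The support [p, q] of the bump lies strictly inside [a, b], which makes all
    boundary terms vanish at \<open>a\<close> and \<open>b\<close>.\<close>
  define a b p q where "a = s0 - r" and "b = s0 + r" and "p = s0 - r / 2" and "q = s0 + r / 2"
  have ab: "a < p" "p < s0" "s0 < q" "q < b" using r(1) by (auto simp: a_def b_def p_def q_def)
  have abJ: "{a..b} \<subseteq> J"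
    using r(2) by (auto simp: a_def b_def cball_def dist_real_def subset_iff abs_le_iff)
  obtain \<psi> :: "real \<Rightarrow> real" where "smooth_on UNIV \<psi> \<and> (\<forall>s. \<psi> s \<ge> 0) \<and>
    (\<forall>s. p < s \<and> s < q \<longrightarrow> \<psi> s > 0) \<and> (\<forall>s. s \<le> p \<or> q \<le> s \<longrightarrow> \<psi> s = 0)"
    using smooth_bump_exists[of p q] ..
  then have \<psi>: "smooth_on UNIV \<psi>" "\<And>s. \<psi> s \<ge> 0" "\<And>s. p < s \<Longrightarrow> s < q \<Longrightarrow> \<psi> s > 0"
    "\<And>s. s \<le> p \<or> q \<le> s \<Longrightarrow> \<psi> s = 0" by blast+
  define D where "D h = (\<lambda>s. frechet_derivative h (at s) 1)" for h :: "real \<Rightarrow> real"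
  have D: "smooth_on J (D h)" if "smooth_on J h" for h
    unfolding D_def by (rule smooth_on_frechet_derivative[OF that])
  have DD: "(h has_real_derivative D h s) (at s)" if "smooth_on J h" "s \<in> J" for h s
    unfolding D_def by (rule smooth_on_DERIV[OF that])
  have fJ: "smooth_on J f" by (rule smooth_on_mono[OF f JI])
  define u where "u s = 3 * k\<^sup>2 * D f s - D (D (D f)) s" for s
  define w where "w s = (k ^ 3 - 2 * k * C) * f s - 3 * k * D (D f) s" for s
  have u: "smooth_on J u" and w: "smooth_on J w"
    unfolding u_def w_def by (intro smooth_on_diff smooth_on_mult smooth_on_const J D fJ)+
  txt \<open>With these coefficients the first variation is a multiple of \<open>\<integral> \<psi> (u\<^sup>2 + w\<^sup>2)\<close>.\<close>
  define \<alpha> where "\<alpha> s = \<psi> s * u s" for s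
  define \<beta> where "\<beta> s = \<psi> s * w s" for s
  have \<alpha>: "smooth_on J \<alpha>" and \<beta>: "smooth_on J \<beta>"
    unfolding \<alpha>_def \<beta>_def by (intro smooth_on_mult J u w smooth_on_mono[OF \<psi>(1)] subset_UNIV)+
  define \<eta> where "\<eta> s = \<alpha> s *\<^sub>R T s + \<beta> s *\<^sub>R n s" for s
  have \<eta>: "smooth_on J \<eta>"
    unfolding \<eta>_def by (intro smooth_on_add smooth_on_scaleR J \<alpha> \<beta> T n)
  have supp: "\<eta> s = 0" if "s \<notin> {p..q}" for s
    using that \<psi>(4)[of s] by (auto simp: \<eta>_def \<alpha>_def \<beta>_def)
  have pqab: "{p..q} \<subseteq> {a..b}" using ab by auto
  \<comment> \<open>A uniform distance from the compact arc to the boundary of the coordinate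
    domain. Divided by a bound for \<eta> it gives a time \<epsilon> for which the affine motion
    stays in the domain.\<close>
  obtain \<delta> where \<delta>: "\<delta> > 0" "(\<Union>z\<in>x ` {a..b}. ball z \<delta>) \<subseteq> U"
  proof (rule compact_subset_open_imp_ball_epsilon_subset)
    show "compact (x ` {a..b})"
      by (intro compact_continuous_image continuous_on_subset[OF smooth_on_continuous_on[OF x] abJ]) simp
    show "open U" by (rule open_U)
    show "x ` {a..b} \<subseteq> U" using xU abJ by auto
  qed
  have "bounded (\<eta> ` {a..b})"
    by (intro compact_imp_bounded compact_continuous_image
        continuous_on_subset[OF smooth_on_continuous_on[OF \<eta>] abJ]) simp
  then obtain R where R: "R > 0" "\<And>s. s \<in> {a..b} \<Longrightarrow> norm (\<eta> s) \<le> R"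
    unfolding bounded_pos by auto
  define \<epsilon> where "\<epsilon> = \<delta> / R"
  have \<epsilon>: "\<epsilon> > 0" using \<delta> R by (simp add: \<epsilon>_def)
  have yU: "x s + t *\<^sub>R \<eta> s \<in> U" if t: "\<bar>t\<bar> < \<epsilon>" and s: "s \<in> J" for t s
  proof (cases "s \<in> {a..b}")
    case True
    have "norm (t *\<^sub>R \<eta> s) \<le> \<bar>t\<bar> * R" using R(2)[OF True] by (simp add: mult_left_mono)
    also have "\<dots> < \<delta>" using t R(1) by (simp add: \<epsilon>_def pos_less_divide_eq)
    finally have "x s + t *\<^sub>R \<eta> s \<in> ball (x s) \<delta>" by (simp add: dist_norm)
    then show ?thesis using \<delta>(2) True by blast
  next
    case False
    then have "\<eta> s = 0" using supp[of s] pqab by blast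
    then show ?thesis using xU[OF s] by simp
  qed
  have yU': "cmap c (\<gamma> s) + t *\<^sub>R \<eta> s \<in> cmap c ` cdom c"
    if "\<bar>t\<bar> < \<epsilon>" "s \<in> I" "\<gamma> s \<in> cdom c" for t s
    using yU[of t s] that by (simp add: x_def U_def J_def)
  have pqJ: "{p..q} \<subseteq> {s\<in>I. \<gamma> s \<in> cdom c}" using subset_trans[OF pqab abJ] unfolding J_def .
  have "\<exists>\<Phi>. variation_supported_in M I \<gamma> {p..q} \<epsilon> \<Phi> \<and>
    (\<forall>t s. \<bar>t\<bar> < \<epsilon> \<and> s \<in> I \<and> \<gamma> s \<in> cdom c \<longrightarrow>
      \<Phi> t s \<in> cdom c \<and> cmap c (\<Phi> t s) = cmap c (\<gamma> s) + t *\<^sub>R \<eta> s)"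
    by (rule chart_variation[OF sM I \<gamma> c(1) compact_Icc \<eta>[unfolded J_def] pqJ supp \<epsilon> yU'])
  then obtain \<Phi> where \<Phi>: "variation_supported_in M I \<gamma> {p..q} \<epsilon> \<Phi>"
    and \<Phi>y: "\<And>t s. \<bar>t\<bar> < \<epsilon> \<Longrightarrow> s \<in> I \<Longrightarrow> \<gamma> s \<in> cdom c \<Longrightarrow>
      \<Phi> t s \<in> cdom c \<and> cmap c (\<Phi> t s) = cmap c (\<gamma> s) + t *\<^sub>R \<eta> s"
    by auto
  define P where "P = {-\<epsilon><..<\<epsilon>} \<times> J"
  define y where "y z = x (snd z) + fst z *\<^sub>R \<eta> (snd z)" for z :: "real \<times> real"
  have P: "open P" using J by (simp add: P_def open_Times)
  have comp_snd: "smooth_on P (\<lambda>z. h (snd z))" if "smooth_on J h" for h :: "real \<Rightarrow> real^2"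
    by (rule smooth_on_compose[OF P J _ smooth_on_snd[OF P] that]) (auto simp: P_def)
  have y: "smooth_on P y" "y ` P \<subseteq> U"
    unfolding y_def
    by (intro smooth_on_add smooth_on_scaleR P smooth_on_fst comp_snd x \<eta>) (use yU in \<open>auto simp: P_def\<close>)
  define B where "B = cov G y (0, 1) (cov G y (0, 1) (\<lambda>z. frechet_derivative y (at z) (0, 1)))"
  have B: "smooth_on P B"
    unfolding B_def by (intro smooth_on_cov P y smooth_on_frechet_derivative)
  define E where "E z = g (y z) (B z) (B z)" for z
  have E: "smooth_on P E"
    unfolding E_def by (rule smooth_bilinear_on_compose[OF smooth_metric P y B B])
  have energy: "energy3 M f {a..b} (\<Phi> t) = 1/2 * integral {a..b} (\<lambda>s. f s * E (t, s))" if t: "\<bar>t\<bar> < \<epsilon>" for t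
  proof -
    have "(norm_along M (\<Phi> t) (covariant_deriv M (\<Phi> t) (tension M (\<Phi> t))) s)\<^sup>2 = E (t, s)" if "s \<in> J" for s
      unfolding E_def B_def G_def g_def
      by (rule norm_third_derivative_family[OF M c(1) P y[unfolded U_def] J _ _ that])
        (use t \<Phi>y[OF t] in \<open>auto simp: P_def J_def y_def x_def\<close>)
    then show ?thesis
      unfolding energy3_def using abJ by (intro arg_cong2[where f = "(*)"] refl integral_cong) auto
  qed
  have abI: "{a..b} \<subseteq> I" using abJ JI by auto
  have "((\<lambda>t. energy3 M f {a..b} (\<Phi> t)) has_real_derivative 0) (at 0)"
    using harm \<Phi> abI pqab unfolding f_3_harmonic_def by (blast intro: compact_Icc)
  then have "((\<lambda>t. 1/2 * integral {a..b} (\<lambda>s. f s * E (t, s))) has_real_derivative 0) (at 0)"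
    by (rule has_field_derivative_transform_within_open[where S = "{-\<epsilon><..<\<epsilon>}"])
      (use \<epsilon> energy in auto)
  moreover have fc: "continuous_on {a..b} f"
    by (rule continuous_on_subset[OF smooth_on_continuous_on[OF fJ] abJ])
  have abP: "{-\<epsilon><..<\<epsilon>} \<times> {a..b} \<subseteq> P" using abJ by (auto simp: P_def)
  have "((\<lambda>t. 1/2 * integral {a..b} (\<lambda>s. f s * E (t, s))) has_real_derivative
      1/2 * integral {a..b} (\<lambda>s. f s * frechet_derivative E (at (0, s)) (1, 0))) (at 0)"
    by (rule DERIV_cmult[OF weighted_integral_has_derivative[OF P abP E fc \<epsilon>]])
  ultimately have int0: "integral {a..b} (\<lambda>s. f s * frechet_derivative E (at (0, s)) (1, 0)) = 0"
    using DERIV_unique by fastforce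
  define m where "m = k ^ 3 - 2 * k * C"
  define Q where "Q s = D (D (D \<alpha>)) s - 3 * k * D (D \<beta>) s - 3 * k\<^sup>2 * D \<alpha> s + m * \<beta> s" for s
  have y0: "(\<lambda>s. y (0, s)) = x" by (simp add: y_def fun_eq_iff)
  have zP: "(0, s) \<in> P" if "s \<in> J" for s using that \<epsilon> by (simp add: P_def)
  have ys: "frechet_derivative y (at (0, s)) (0, 1) = T s" if "s \<in> J" for s
    using frechet_derivative_slice[OF smooth_on_differentiable[OF y(1) zP[OF that]], of 1]
    by (simp add: y0 T_def)
  have yt: "frechet_derivative y (at (0, s)) (1, 0) = \<eta> s" if "s \<in> J" for s
  proof -
    have "((\<lambda>t. (t, s)) has_derivative (\<lambda>h. (h, 0))) (at (0::real))"
      by (auto intro!: derivative_eq_intros)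
    moreover have "(y has_derivative frechet_derivative y (at (0, s))) (at (0, s))"
      by (rule smooth_on_has_derivative[OF y(1) zP[OF that]])
    ultimately have "((\<lambda>t. y (t, s)) has_derivative (\<lambda>h. frechet_derivative y (at (0, s)) (h, 0))) (at 0)"
      by (rule has_derivative_compose)
    moreover have "((\<lambda>t. y (t, s)) has_derivative (\<lambda>h. h *\<^sub>R \<eta> s)) (at 0)"
      unfolding y_def by (auto intro!: derivative_eq_intros)
    ultimately have "(\<lambda>h. frechet_derivative y (at (0, s)) (h, 0)) = (\<lambda>h. h *\<^sub>R \<eta> s)"
      by (rule has_derivative_unique)
    from fun_cong[OF this, of 1] show ?thesis by simp
  qed
  \<comment> \<open>\<open>E\<close> is the full squared norm, hence the factor 2 in comparison with
    the density formula.\<close>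
  have dens: "frechet_derivative E (at (0, s)) (1, 0) = - 2 * k\<^sup>2 * Q s" if s: "s \<in> J" for s
  proof -
    have "y (0, s) \<in> U" using xU[OF s] fun_cong[OF y0, of s] by simp
    then have "frechet_derivative E (at (0, s)) (1, 0) = 2 * g (y (0, s)) (cov G y (1, 0) B (0, s)) (B (0, s))"
      unfolding E_def
      by (subst frechet_derivative_eqI[OF has_derivative_norm_square])
        (auto intro: smooth_on_differentiable[OF y(1) zP[OF s]] smooth_on_differentiable[OF B zP[OF s]])
    also have "g (y (0, s)) (cov G y (1, 0) B (0, s)) (B (0, s)) = - k\<^sup>2 * Q s"
      unfolding B_def Q_def m_def
    proof (rule density_variation[where J = J and T = T and N = n and C = C and \<alpha> = \<alpha> and \<beta> = \<beta>])
      show "DIM(real^2) = 2" by simp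
      show "frechet_derivative y (at (0, s)) (1, 0) = \<alpha> s *\<^sub>R T s + \<beta> s *\<^sub>R n s" if "s \<in> J" for s
        using yt[OF that] by (simp add: \<eta>_def)
    qed (use s P y J zP ys n in \<open>auto intro: DD D \<alpha> \<beta> K simp: y0 fun_cong[OF y0] on frenet\<close>)
    finally show ?thesis by simp
  qed
  have Qc: "continuous_on {a..b} Q"
    by (rule continuous_on_subset[OF smooth_on_continuous_on abJ])
      (unfold Q_def, intro smooth_on_diff smooth_on_add smooth_on_mult smooth_on_const J D \<alpha> \<beta>)
  have "integral {a..b} (\<lambda>s. f s * frechet_derivative E (at (0, s)) (1, 0)) =
      integral {a..b} (\<lambda>s. (- 2 * k\<^sup>2) * (f s * Q s))"
    using dens abJ by (intro integral_cong) (auto simp: subset_iff)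
  then have "integral {a..b} (\<lambda>s. f s * Q s) = 0" using int0 k by simp
  moreover have "(\<lambda>s. f s * Q s) integrable_on {a..b}"
    by (intro integrable_continuous_real continuous_on_mult fc Qc)
  ultimately have "((\<lambda>s. f s * Q s) has_integral 0) {a..b}"
    by (metis integrable_integral)
  then have Q0: "((\<lambda>s. f s * (D (D (D \<alpha>)) s - 3 * k * D (D \<beta>) s - 3 * k\<^sup>2 * D \<alpha> s + m * \<beta> s)) has_integral 0) {a..b}"
    by (simp only: Q_def)
  \<comment> \<open>An open set off the support that contains \<open>a\<close> and \<open>b\<close>:
    vanishing of the coefficients on it passes to all their derivatives.\<close>
  define W where "W = J \<inter> ({..<p} \<union> {q<..})"
  have W: "open W" using J unfolding W_def by (intro open_Int open_Un open_lessThan open_greaterThan)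
  have DO: "D h s = 0" if "\<And>s. s \<in> W \<Longrightarrow> h s = 0" "s \<in> W" for h s
    unfolding D_def by (rule frechet_derivative_zero_on[OF W that])
  have "\<alpha> s = 0" "\<beta> s = 0" if "s \<in> W" for s
    using \<psi>(4)[of s] that by (auto simp: W_def \<alpha>_def \<beta>_def)
  then have ends: "\<alpha> s = 0 \<and> D \<alpha> s = 0 \<and> D (D \<alpha>) s = 0 \<and> \<beta> s = 0 \<and> D \<beta> s = 0" if "s \<in> W" for s
    using that by (simp add: DO)
  have "a \<in> W" "b \<in> W" using ab abJ by (auto simp: W_def)
  then have ends': "\<alpha> s = 0 \<and> D \<alpha> s = 0 \<and> D (D \<alpha>) s = 0 \<and> \<beta> s = 0 \<and> D \<beta> s = 0" if "s \<in> {a, b}" for s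
    using ends that by blast
  have ab': "a \<le> b" using ab by simp
  have "((\<lambda>s. \<alpha> s * (3 * k\<^sup>2 * D f s - D (D (D f)) s) + \<beta> s * (m * f s - 3 * k * D (D f) s)) has_integral 0) {a..b}"
    by (rule integrate_by_parts[OF ab' _ _ _ _ _ _ _ _ ends' Q0])
      (use abJ in \<open>auto intro!: DD D fJ \<alpha> \<beta>\<close>)
  then have sq: "((\<lambda>s. \<psi> s * ((u s)\<^sup>2 + (w s)\<^sup>2)) has_integral 0) (cbox a b)"
    by (simp add: \<alpha>_def \<beta>_def u_def w_def m_def power2_eq_square algebra_simps)
  have sqc: "continuous_on (cbox a b) (\<lambda>s. \<psi> s * ((u s)\<^sup>2 + (w s)\<^sup>2))"
    unfolding cbox_interval
    by (intro continuous_intros continuous_on_subset[OF smooth_on_continuous_on[OF \<psi>(1)] subset_UNIV]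
        continuous_on_subset[OF smooth_on_continuous_on[OF u] abJ]
        continuous_on_subset[OF smooth_on_continuous_on[OF w] abJ])
  \<comment> \<open>A continuous nonnegative function with integral 0 vanishes on [a, b], and the
    bump function is positive between \<open>p\<close> and \<open>q\<close>. The equations thus hold
    on an interval, so \<open>w = 0\<close> may be differentiated.\<close>
  have uw: "u s = 0 \<and> w s = 0" if s: "s \<in> {p<..<q}" for s
  proof -
    have "\<psi> s * ((u s)\<^sup>2 + (w s)\<^sup>2) = 0"
      by (rule has_integral_0_cbox_imp_0[OF sqc _ sq]) (use ab s \<psi>(2) in auto)
    then show ?thesis using \<psi>(3)[of s] s by (auto simp: sum_power2_eq_zero_iff)
  qed
  have "D w s0 = 0"
    unfolding D_def by (rule frechet_derivative_zero_on[of "{p<..<q}"]) (use uw ab in auto)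
  moreover have "(w has_real_derivative (k ^ 3 - 2 * k * C) * D f s0 - 3 * k * D (D (D f)) s0) (at s0)"
    unfolding w_def using s0J by (auto intro!: derivative_eq_intros DD D fJ)
  then have "D w s0 = (k ^ 3 - 2 * k * C) * D f s0 - 3 * k * D (D (D f)) s0"
    using DERIV_unique DD[OF w s0J] by blast
  moreover have "D (D (D f)) s0 = 3 * k\<^sup>2 * D f s0" using uw[of s0] ab by (simp add: u_def)
  \<comment> \<open>Inserting f''' = 3 k^2 f' into w' = 0 gives (k^3 - 2 k C - 9 k^3) f' =
    0.\<close>
  ultimately have "(2 * k) * D f s0 * (- 4 * k\<^sup>2 - C) = 0"
    by (simp add: power2_eq_square power3_eq_cube algebra_simps)
  then show ?thesis using k f' by (simp add: D_def)
qed

text \<open>A constant nonzero weight only rescales the energy over each compact interval in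
  \<open>I\<close>, so it has the same critical points as weight 1.\<close>

lemma f_3_harmonic_constant:
  assumes "f_3_harmonic M I f \<gamma>" and f: "\<And>s. s \<in> I \<Longrightarrow> f s = r" and r: "r \<noteq> 0"
  shows "three_harmonic M I \<gamma>"
  unfolding three_harmonic_def f_3_harmonic_def
proof (intro conjI allI impI)
  show "smooth_into M I \<gamma>" using assms(1) by (simp add: f_3_harmonic_def)
  fix a b K \<epsilon> \<Phi>
  assume v: "{a..b} \<subseteq> I \<and> compact K \<and> K \<subseteq> {a..b} \<and> variation_supported_in M I \<gamma> K \<epsilon> \<Phi>"
  then have "((\<lambda>t. energy3 M f {a..b} (\<Phi> t)) has_real_derivative 0) (at 0)"
    using assms(1) unfolding f_3_harmonic_def by blast
  from DERIV_cmult[OF this, of "inverse r"]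
  have "((\<lambda>t. inverse r * energy3 M f {a..b} (\<Phi> t)) has_real_derivative 0) (at 0)" by simp
  moreover have "inverse r * energy3 M f {a..b} \<sigma> = energy3 M (\<lambda>_. 1) {a..b} \<sigma>" for \<sigma>
  proof -
    have "energy3 M f {a..b} \<sigma> = 1/2 * integral {a..b} (\<lambda>s. r * (norm_along M \<sigma> (covariant_deriv M \<sigma> (tension M \<sigma>)) s)\<^sup>2)"
      unfolding energy3_def using v f by (intro arg_cong2[where f = "(*)"] refl integral_cong) auto
    then show ?thesis using r by (simp add: energy3_def)
  qed
  ultimately show "((\<lambda>t. energy3 M (\<lambda>_. 1) {a..b} (\<Phi> t)) has_real_derivative 0) (at 0)" by simp
qed

theorem theorem4p3:
  fixes N :: "('a, real^2) manifold" and C :: real and I :: "real set"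
    and f :: "real \<Rightarrow> real" and \<gamma> :: "real \<Rightarrow> 'a" and \<kappa> :: "real \<Rightarrow> real"
  assumes "space_form N C"
    and "open I" and "is_interval I" and "I \<noteq> {}"
    and "smooth_on I f" and "\<forall>s\<in>I. f s > 0"
    and "arclength_parametrized N I \<gamma>"
    and "proper_f_3_harmonic N I f \<gamma>"
    and "has_geodesic_curvature N I \<gamma> \<kappa>"
    and "\<forall>s\<in>I. \<kappa> s > 0"
    and "\<kappa> constant_on I"
  shows "C < 0 \<and> (\<forall>s\<in>I. \<kappa> s = sqrt (- C) / 2)"
proof -
  obtain k where k: "\<And>s. s \<in> I \<Longrightarrow> \<kappa> s = k" using assms(11) by (auto simp: constant_on_def)
  have k0: "k > 0" using assms(4,10) k by force
  have harm: "f_3_harmonic N I f \<gamma>" "\<not> three_harmonic N I \<gamma>"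
    using assms(8) by (auto simp: proper_f_3_harmonic_def)
  have "\<exists>s0\<in>I. frechet_derivative f (at s0) 1 \<noteq> 0"
  proof (rule ccontr)
    assume "\<not> ?thesis"
    then have "(f has_real_derivative 0) (at s within I)" if "s \<in> I" for s
      using smooth_on_DERIV[OF assms(5) that] that by (auto intro: has_field_derivative_at_within)
    \<comment> \<open>Convexity of the interval turns a vanishing derivative into one constant for
      all of \<open>I\<close>; positivity of \<open>f\<close> makes this constant nonzero.\<close>
    then obtain r where r: "\<And>s. s \<in> I \<Longrightarrow> f s = r"
      using has_field_derivative_zero_constant[of I f] is_interval_convex[OF assms(3)] by blast
    then have "r \<noteq> 0" using assms(4,6) by force
    with f_3_harmonic_constant[OF harm(1) r] harm(2) show False by simp
  qed
  then obtain s0 where s0: "s0 \<in> I" "frechet_derivative f (at s0) 1 \<noteq> 0" by blast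
  have "C = - 4 * k\<^sup>2"
    by (rule constant_curvature_identity[OF _ _ assms(2,5) _ harm(1) assms(9) k k0 s0])
      (use assms(1,7) in \<open>auto simp: space_form_def arclength_parametrized_def\<close>)
  then have "C < 0" "sqrt (- C) = 2 * k"
    using k0 by (simp_all add: real_sqrt_mult)
  then show ?thesis using k by simp
qed

end
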